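(* Let $(X,d)$ be a quasi-pseudometric space. The functors $CN(X)\otimes_{\boldsymbol{[0,\infty)}}A_{-}$ and $M(X)$ from $\boldsymbol{[0,\infty)}$ to $\mathrm{ch}_{\mathrm{Ab}}$ are (naturally) isomorphic. In particular, the magnitude homology of $X$, i.e. the homology of $M(X)$, is isomorphic to the homology of $CN(X)\otimes_{\boldsymbol{[0,\infty)}}A_{-}$.
   Context: A quasi-pseudometric space is a set $X$ with $d\colon X\times X\to[0,\infty)$ satisfying $d(x,x)=0$ and the triangle inequality $d(x,z)\le d(x,y)+d(y,z)$ ($d$ need not be symmetric, and distinct points may have distance $0$). The length of a tuple $(x_0,\dots,x_n)$ of points of $X$ is $\sum_{i=0}^{n-1}d(x_i,x_{i+1})$. Let $\boldsymbol{[0,\infty)}$ be the category whose objects are the non-negative real numbers, with exactly one morphism $\epsilon\to\epsilon'$ whenever $\epsilon\le\epsilon'$ (and no others). $\mathrm{Ab}$ is the category of abelian groups, $\mathrm{ch}_{\mathrm{Ab}}$ the category of chain complexes of abelian groups, $\boxtimes$ the tensor product of abelian groups and the induced tensor product of chain complexes; abelian groups are regarded as chain complexes concentrated in degree $0$. The complex $M(X)$: it is the chain complex of $[0,\infty)$-graded abelian groups $$M(X)_n=\bigoplus_{l\in[0,\infty)}\mathbb{Z}\big[\{(x_0,\dots,x_n)\in X^{n+1}\mid (x_0,\dots,x_n)\text{ has length exactly }l\}\big],$$ with boundary map $d_n=\sum_{i=0}^n(-1)^i d_n^i$, where for $1\le i\le n-1$, $d_n^i(x_0,\dots,x_n)=(x_0,\dots,x_{i-1},x_{i+1},\dots,x_n)$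 if $d(x_{i-1},x_i)+d(x_i,x_{i+1})=d(x_{i-1},x_{i+1})$ and $0$ otherwise; $d_n^0(x_0,\dots,x_n)=(x_1,\dots,x_n)$ if $d(x_0,x_1)=0$ and $0$ otherwise; $d_n^n(x_0,\dots,x_n)=(x_0,\dots,x_{n-1})$ if $d(x_{n-1},x_n)=0$ and $0$ otherwise. Its homology is the magnitude homology of $X$. Identifying chain complexes of $[0,\infty)$-graded abelian groups with $[0,\infty)$-graded chain complexes, $M(X)$ is regarded as the functor $\boldsymbol{[0,\infty)}\to\mathrm{ch}_{\mathrm{Ab}}$ that sends $\epsilon$ to the degree-$\epsilon$ part of $M(X)$ and sends every non-identity morphism to the zero chain map. The functor $CN(X)\colon\boldsymbol{[0,\infty)}\to\mathrm{ch}_{\mathrm{Ab}}$: it is the composite of the enriched nerve $N(X)\colon\boldsymbol{[0,\infty)}\to\mathrm{sSet}$, $N(X)(\epsilon)_n=\{(x_0,\dots,x_n)\in X^{n+1}\mid\sum_{i=0}^{n-1}d(x_i,x_{i+1})\le\epsilon\}$ (faces delete an entry, degeneracies repeat an entry, $\epsilon\le\epsilon'$ is sent to the inclusion), with the free abelian group functor $\mathrm{sSet}\to\mathrm{sAb}$ and the unnormalised chain complex functor $\mathrm{sAb}\to\mathrm{ch}_{\mathrm{Ab}}$. Coends: for $A\colon\boldsymbol{[0,\infty)}^{\mathrm{op}}\to\mathrm{Ab}\hookrightarrow\mathrm{ch}_{\mathrm{Ab}}$, $CN(X)\otimes_{\boldsymbol{[0,\infty)}}A$ is the coequaliser of the two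 maps $$\bigoplus_{\ell\le\ell'} CN(X)(\ell)\boxtimes A(\ell')\rightrightarrows\bigoplus_{\ell\in[0,\infty)}CN(X)(\ell)\boxtimes A(\ell)$$ induced by $CN(X)(\ell\le\ell')\boxtimes1$ and $1\boxtimes A(\ell\le\ell')$. Coefficient functors: for $\epsilon\in[0,\infty)$, $A_\epsilon\colon\boldsymbol{[0,\infty)}^{\mathrm{op}}\to\mathrm{Ab}$ sends $\ell$ to $\mathbb{Z}$ if $\ell=\epsilon$ and to $0$ otherwise, and sends $\ell\ge\ell'$ to $\mathrm{id}_{\mathbb{Z}}$ if $\ell=\ell'=\epsilon$ and to $0$ otherwise. For $\epsilon\le\epsilon'$ the natural transformation $A_\epsilon\Rightarrow A_{\epsilon'}$ whose component at $\ell$ is the identity if $\ell=\epsilon=\epsilon'$ and zero otherwise induces a chain map $CN(X)\otimes_{\boldsymbol{[0,\infty)}}A_\epsilon\to CN(X)\otimes_{\boldsymbol{[0,\infty)}}A_{\epsilon'}$; this defines the functor $CN(X)\otimes_{\boldsymbol{[0,\infty)}}A_{-}\colon\boldsymbol{[0,\infty)}\to\mathrm{ch}_{\mathrm{Ab}}$. *)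

theory Defs
  imports Complex_Main "HOL-Algebra.Free_Abelian_Groups"
begin

text \<open>
  Abelian groups are rendered by the (multiplicatively written) locale \<^locale>\<open>comm_group\<close>, so that
  \<open>\<otimes>\<close> is addition, \<open>\<one>\<close> is zero and \<open>inv\<close> is negation. Maps between groups only matter on carriers.
\<close>

section \<open>Quasi-pseudometric spaces\<close>

locale quasi_pseudometric_space =
  fixes X :: "'x set" and d :: "'x \<Rightarrow> 'x \<Rightarrow> real"
  assumes nonneg: "\<lbrakk>x \<in> X; y \<in> X\<rbrakk> \<Longrightarrow> 0 \<le> d x y"
    and refl_zero: "x \<in> X \<Longrightarrow> d x x = 0"
    and triangle: "\<lbrakk>x \<in> X; y \<in> X; z \<in> X\<rbrakk> \<Longrightarrow> d x z \<le> d x y + d y z"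

definition tuples :: "'x set \<Rightarrow> nat \<Rightarrow> 'x list set" where
  "tuples X n = {xs. length xs = Suc n \<and> set xs \<subseteq> X}"

definition tuple_length :: "('x \<Rightarrow> 'x \<Rightarrow> real) \<Rightarrow> 'x list \<Rightarrow> real" where
  "tuple_length d xs = (\<Sum>i<length xs - 1. d (xs ! i) (xs ! Suc i))"

definition delete_entry :: "nat \<Rightarrow> 'x list \<Rightarrow> 'x list" where
  "delete_entry i xs = take i xs @ drop (Suc i) xs"

definition repeat_entry :: "nat \<Rightarrow> 'x list \<Rightarrow> 'x list" where
  "repeat_entry i xs = take (Suc i) xs @ drop i xs"


section \<open>Group-theoretic constructions\<close>

text \<open>
  The map \<open>G / K \<rightarrow> H / N\<close> induced by \<open>f : G \<rightarrow> H\<close> with \<open>f ` K \<subseteq> N\<close>: it sends the coset of \<open>x\<close> to the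
  coset \<open>N <#> f ` (K #> x) = N #> f x\<close>.
\<close>
definition quot_map :: "'b monoid \<Rightarrow> 'b set \<Rightarrow> ('a \<Rightarrow> 'b) \<Rightarrow> 'a set \<Rightarrow> 'b set" where
  "quot_map H N f c = N <#>\<^bsub>H\<^esub> (f ` c)"

definition sum_inj :: "'i set \<Rightarrow> ('i \<Rightarrow> 'a monoid) \<Rightarrow> 'i \<Rightarrow> 'a \<Rightarrow> 'i \<Rightarrow> 'a" where
  "sum_inj I G j x = (\<lambda>i\<in>I. if i = j then x else \<one>\<^bsub>G i\<^esub>)"

definition tensor_relations :: "'a monoid \<Rightarrow> 'b monoid \<Rightarrow> ('a \<times> 'b \<Rightarrow>\<^sub>0 int) set" where
  "tensor_relations G H =
     {frag_of (x \<otimes>\<^bsub>G\<^esub> x', y) - frag_of (x, y) - frag_of (x', y) | x x' y.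
        x \<in> carrier G \<and> x' \<in> carrier G \<and> y \<in> carrier H} \<union>
     {frag_of (x, y \<otimes>\<^bsub>H\<^esub> y') - frag_of (x, y) - frag_of (x, y') | x y y'.
        x \<in> carrier G \<and> y \<in> carrier H \<and> y' \<in> carrier H}"

definition tensor_subgroup :: "'a monoid \<Rightarrow> 'b monoid \<Rightarrow> ('a \<times> 'b \<Rightarrow>\<^sub>0 int) set" where
  "tensor_subgroup G H =
     generate (free_Abelian_group (carrier G \<times> carrier H)) (tensor_relations G H)"

definition tensor_group :: "'a monoid \<Rightarrow> 'b monoid \<Rightarrow> ('a \<times> 'b \<Rightarrow>\<^sub>0 int) set monoid" where
  "tensor_group G H = free_Abelian_group (carrier G \<times> carrier H) Mod tensor_subgroup G H"

text \<open>\<open>tensor_map G' H' f g\<close> is \<open>f \<boxtimes> g : G \<boxtimes> H \<rightarrow> G' \<boxtimes> H'\<close> for \<open>f : G \<rightarrow> G'\<close> and \<open>g : H \<rightarrow> H'\<close>.\<close>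
definition tensor_map :: "'c monoid \<Rightarrow> 'd monoid \<Rightarrow> ('a \<Rightarrow> 'c) \<Rightarrow> ('b \<Rightarrow> 'd) \<Rightarrow>
    ('a \<times> 'b \<Rightarrow>\<^sub>0 int) set \<Rightarrow> ('c \<times> 'd \<Rightarrow>\<^sub>0 int) set" where
  "tensor_map G' H' f g =
     quot_map (free_Abelian_group (carrier G' \<times> carrier H')) (tensor_subgroup G' H')
       (frag_extend (\<lambda>(x, y). frag_of (f x, g y)))"


section \<open>Chain complexes\<close>

text \<open>All complexes are non-negatively graded; \<open>bdry C n\<close> goes from degree \<open>n + 1\<close> to degree \<open>n\<close>.\<close>
record 'a complex_data =
  chains :: "nat \<Rightarrow> 'a monoid"
  bdry :: "nat \<Rightarrow> 'a \<Rightarrow> 'a"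

definition chain_complex :: "'a complex_data \<Rightarrow> bool" where
  "chain_complex C \<longleftrightarrow>
     (\<forall>n. comm_group (chains C n)) \<and>
     (\<forall>n. bdry C n \<in> hom (chains C (Suc n)) (chains C n)) \<and>
     (\<forall>n. \<forall>x\<in>carrier (chains C (Suc (Suc n))). bdry C n (bdry C (Suc n) x) = \<one>\<^bsub>chains C n\<^esub>)"

definition chain_map :: "'a complex_data \<Rightarrow> 'b complex_data \<Rightarrow> (nat \<Rightarrow> 'a \<Rightarrow> 'b) \<Rightarrow> bool" where
  "chain_map C D f \<longleftrightarrow>
     (\<forall>n. f n \<in> hom (chains C n) (chains D n)) \<and>
     (\<forall>n. \<forall>x\<in>carrier (chains C (Suc n)). f n (bdry C n x) = bdry D n (f (Suc n) x))"

definition chain_iso :: "'a complex_data \<Rightarrow> 'b complex_data \<Rightarrow> (nat \<Rightarrow> 'a \<Rightarrow> 'b) \<Rightarrow> bool" where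
  "chain_iso C D f \<longleftrightarrow> chain_map C D f \<and> (\<forall>n. f n \<in> iso (chains C n) (chains D n))"

definition concentrated :: "'a monoid \<Rightarrow> 'a complex_data" where
  "concentrated A =
     \<lparr>chains = (\<lambda>n. if n = 0 then A else singleton_group \<one>\<^bsub>A\<^esub>), bdry = (\<lambda>n x. \<one>\<^bsub>A\<^esub>)\<rparr>"

text \<open>The chain map into \<open>concentrated B\<close> induced by a homomorphism into \<open>B\<close>.\<close>
definition concentrated_map :: "'b monoid \<Rightarrow> ('a \<Rightarrow> 'b) \<Rightarrow> nat \<Rightarrow> 'a \<Rightarrow> 'b" where
  "concentrated_map B f n = (if n = 0 then f else (\<lambda>x. \<one>\<^bsub>B\<^esub>))"

definition sum_complex :: "'i set \<Rightarrow> ('i \<Rightarrow> 'a complex_data) \<Rightarrow> ('i \<Rightarrow> 'a) complex_data" where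
  "sum_complex I C =
     \<lparr>chains = (\<lambda>n. sum_group I (\<lambda>i. chains (C i) n)),
      bdry = (\<lambda>n x. \<lambda>i\<in>I. bdry (C i) n (x i))\<rparr>"

definition bidegrees :: "nat \<Rightarrow> (nat \<times> nat) set" where
  "bidegrees n = {(p, q). p + q = n}"

text \<open>The differential is \<open>\<partial>(x \<boxtimes> y) = \<partial>x \<boxtimes> y + (-1)\<^sup>p (x \<boxtimes> \<partial>y)\<close> for \<open>x\<close> of degree \<open>p\<close>.\<close>
definition tensor_complex ::
    "'a complex_data \<Rightarrow> 'b complex_data \<Rightarrow> (nat \<times> nat \<Rightarrow> ('a \<times> 'b \<Rightarrow>\<^sub>0 int) set) complex_data" where
  "tensor_complex C D =
     \<lparr>chains = (\<lambda>n. sum_group (bidegrees n) (\<lambda>(p, q). tensor_group (chains C p) (chains D q))),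
      bdry = (\<lambda>n x. \<lambda>(p, q)\<in>bidegrees n.
        tensor_map (chains C p) (chains D q) (bdry C p) id (x (Suc p, q))
        \<otimes>\<^bsub>tensor_group (chains C p) (chains D q)\<^esub>
        tensor_map (chains C p) (chains D q) id (bdry D q) (x (p, Suc q))
          [^]\<^bsub>tensor_group (chains C p) (chains D q)\<^esub> ((-1) ^ p :: int))\<rparr>"

definition tensor_chain_map :: "'c complex_data \<Rightarrow> 'd complex_data \<Rightarrow>
    (nat \<Rightarrow> 'a \<Rightarrow> 'c) \<Rightarrow> (nat \<Rightarrow> 'b \<Rightarrow> 'd) \<Rightarrow> nat \<Rightarrow>
    (nat \<times> nat \<Rightarrow> ('a \<times> 'b \<Rightarrow>\<^sub>0 int) set) \<Rightarrow> (nat \<times> nat \<Rightarrow> ('c \<times> 'd \<Rightarrow>\<^sub>0 int) set)" where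
  "tensor_chain_map C' D' f g n x =
     (\<lambda>(p, q)\<in>bidegrees n. tensor_map (chains C' p) (chains D' q) (f p) (g q) (x (p, q)))"

text \<open>
  Coequalisers of chain maps \<open>f, g : C \<rightarrow> D\<close> are formed degreewise: \<open>D\<^sub>n\<close> modulo the image of \<open>f - g\<close>.
\<close>
definition coeq_subgroup :: "'a complex_data \<Rightarrow> 'b complex_data \<Rightarrow>
    (nat \<Rightarrow> 'a \<Rightarrow> 'b) \<Rightarrow> (nat \<Rightarrow> 'a \<Rightarrow> 'b) \<Rightarrow> nat \<Rightarrow> 'b set" where
  "coeq_subgroup C D f g n =
     (\<lambda>x. f n x \<otimes>\<^bsub>chains D n\<^esub> inv\<^bsub>chains D n\<^esub> (g n x)) ` carrier (chains C n)"

definition coequaliser :: "'a complex_data \<Rightarrow> 'b complex_data \<Rightarrow>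
    (nat \<Rightarrow> 'a \<Rightarrow> 'b) \<Rightarrow> (nat \<Rightarrow> 'a \<Rightarrow> 'b) \<Rightarrow> 'b set complex_data" where
  "coequaliser C D f g =
     \<lparr>chains = (\<lambda>n. chains D n Mod coeq_subgroup C D f g n),
      bdry = (\<lambda>n. quot_map (chains D n) (coeq_subgroup C D f g n) (bdry D n))\<rparr>"

fun cycles :: "'a complex_data \<Rightarrow> nat \<Rightarrow> 'a set" where
  "cycles C 0 = carrier (chains C 0)"
| "cycles C (Suc n) = kernel (chains C (Suc n)) (chains C n) (bdry C n)"

definition boundaries :: "'a complex_data \<Rightarrow> nat \<Rightarrow> 'a set" where
  "boundaries C n = bdry C n ` carrier (chains C (Suc n))"

definition homology :: "nat \<Rightarrow> 'a complex_data \<Rightarrow> 'a set monoid" where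
  "homology n C = subgroup_generated (chains C n) (cycles C n) Mod boundaries C n"


section \<open>Functors on the poset of non-negative reals\<close>

text \<open>
  The maps \<open>mor F s t\<close> are only relevant for \<open>0 \<le> s \<le> t\<close>. They go from \<open>obj F s\<close> to \<open>obj F t\<close> for
  covariant functors, and from \<open>obj F t\<close> to \<open>obj F s\<close> for contravariant ones.
\<close>
record ('o, 'm) diagram =
  obj :: "real \<Rightarrow> 'o"
  mor :: "real \<Rightarrow> real \<Rightarrow> 'm"

type_synonym 'a ch_diagram = "('a complex_data, nat \<Rightarrow> 'a \<Rightarrow> 'a) diagram"
type_synonym 'a ab_diagram = "('a monoid, 'a \<Rightarrow> 'a) diagram"

definition ch_functor :: "'a ch_diagram \<Rightarrow> bool" where
  "ch_functor F \<longleftrightarrow>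
     (\<forall>s\<ge>0. chain_complex (obj F s)) \<and>
     (\<forall>s\<ge>0. \<forall>t\<ge>s. chain_map (obj F s) (obj F t) (mor F s t)) \<and>
     (\<forall>s\<ge>0. \<forall>n. \<forall>x\<in>carrier (chains (obj F s) n). mor F s s n x = x) \<and>
     (\<forall>s\<ge>0. \<forall>t\<ge>s. \<forall>u\<ge>t. \<forall>n. \<forall>x\<in>carrier (chains (obj F s) n).
        mor F s u n x = mor F t u n (mor F s t n x))"

definition ch_naturally_isomorphic :: "'a ch_diagram \<Rightarrow> 'b ch_diagram \<Rightarrow> bool" where
  "ch_naturally_isomorphic F G \<longleftrightarrow> ch_functor F \<and> ch_functor G \<and>
     (\<exists>\<eta>. (\<forall>s\<ge>0. chain_iso (obj F s) (obj G s) (\<eta> s)) \<and>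
       (\<forall>s\<ge>0. \<forall>t\<ge>s. \<forall>n. \<forall>x\<in>carrier (chains (obj F s) n).
          \<eta> t n (mor F s t n x) = mor G s t n (\<eta> s n x)))"

definition ab_functor :: "'a ab_diagram \<Rightarrow> bool" where
  "ab_functor F \<longleftrightarrow>
     (\<forall>s\<ge>0. comm_group (obj F s)) \<and>
     (\<forall>s\<ge>0. \<forall>t\<ge>s. mor F s t \<in> hom (obj F s) (obj F t)) \<and>
     (\<forall>s\<ge>0. \<forall>x\<in>carrier (obj F s). mor F s s x = x) \<and>
     (\<forall>s\<ge>0. \<forall>t\<ge>s. \<forall>u\<ge>t. \<forall>x\<in>carrier (obj F s). mor F s u x = mor F t u (mor F s t x))"

definition ab_naturally_isomorphic :: "'a ab_diagram \<Rightarrow> 'b ab_diagram \<Rightarrow> bool" where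
  "ab_naturally_isomorphic F G \<longleftrightarrow> ab_functor F \<and> ab_functor G \<and>
     (\<exists>\<eta>. (\<forall>s\<ge>0. \<eta> s \<in> iso (obj F s) (obj G s)) \<and>
       (\<forall>s\<ge>0. \<forall>t\<ge>s. \<forall>x\<in>carrier (obj F s). \<eta> t (mor F s t x) = mor G s t (\<eta> s x)))"

definition homology_functor :: "nat \<Rightarrow> 'a ch_diagram \<Rightarrow> 'a set ab_diagram" where
  "homology_functor n F =
     \<lparr>obj = (\<lambda>s. homology n (obj F s)),
      mor = (\<lambda>s t. quot_map (chains (obj F t) n) (boundaries (obj F t) n) (mor F s t n))\<rparr>"

text \<open>Postcomposition of a contravariant functor with the inclusion of abelian groups in degree 0.\<close>
definition concentrated_cofunctor :: "'a ab_diagram \<Rightarrow> 'a ch_diagram" where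
  "concentrated_cofunctor A =
     \<lparr>obj = (\<lambda>s. concentrated (obj A s)),
      mor = (\<lambda>s t. concentrated_map (obj A s) (mor A s t))\<rparr>"


section \<open>Coends\<close>

text \<open>In this section \<open>F\<close> is covariant and \<open>A\<close> is contravariant, both with values in chain complexes.\<close>

definition coend_source :: "'a ch_diagram \<Rightarrow> 'b ch_diagram \<Rightarrow>
    (real \<times> real \<Rightarrow> nat \<times> nat \<Rightarrow> ('a \<times> 'b \<Rightarrow>\<^sub>0 int) set) complex_data" where
  "coend_source F A =
     sum_complex {(s, t). 0 \<le> s \<and> s \<le> t} (\<lambda>(s, t). tensor_complex (obj F s) (obj A t))"

definition coend_target :: "'a ch_diagram \<Rightarrow> 'b ch_diagram \<Rightarrow>
    (real \<Rightarrow> nat \<times> nat \<Rightarrow> ('a \<times> 'b \<Rightarrow>\<^sub>0 int) set) complex_data" where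
  "coend_target F A = sum_complex {0..} (\<lambda>s. tensor_complex (obj F s) (obj A s))"

definition coend_inj :: "'a ch_diagram \<Rightarrow> 'b ch_diagram \<Rightarrow> real \<Rightarrow> nat \<Rightarrow>
    (nat \<times> nat \<Rightarrow> ('a \<times> 'b \<Rightarrow>\<^sub>0 int) set) \<Rightarrow> real \<Rightarrow> nat \<times> nat \<Rightarrow> ('a \<times> 'b \<Rightarrow>\<^sub>0 int) set" where
  "coend_inj F A t n = sum_inj {0..} (\<lambda>s. chains (tensor_complex (obj F s) (obj A s)) n) t"

text \<open>On the summand \<open>(s, t)\<close> this is \<open>F(s \<le> t) \<boxtimes> 1\<close>, landing in the summand \<open>t\<close>.\<close>
definition coend_left :: "'a ch_diagram \<Rightarrow> 'b ch_diagram \<Rightarrow> nat \<Rightarrow>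
    (real \<times> real \<Rightarrow> nat \<times> nat \<Rightarrow> ('a \<times> 'b \<Rightarrow>\<^sub>0 int) set) \<Rightarrow>
    real \<Rightarrow> nat \<times> nat \<Rightarrow> ('a \<times> 'b \<Rightarrow>\<^sub>0 int) set" where
  "coend_left F A n x =
     gfinprod (chains (coend_target F A) n)
       (\<lambda>(s, t). coend_inj F A t n
          (tensor_chain_map (obj F t) (obj A t) (mor F s t) (\<lambda>q. id) n (x (s, t))))
       {(s, t). 0 \<le> s \<and> s \<le> t}"

text \<open>On the summand \<open>(s, t)\<close> this is \<open>1 \<boxtimes> A(s \<le> t)\<close>, landing in the summand \<open>s\<close>.\<close>
definition coend_right :: "'a ch_diagram \<Rightarrow> 'b ch_diagram \<Rightarrow> nat \<Rightarrow>
    (real \<times> real \<Rightarrow> nat \<times> nat \<Rightarrow> ('a \<times> 'b \<Rightarrow>\<^sub>0 int) set) \<Rightarrow>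
    real \<Rightarrow> nat \<times> nat \<Rightarrow> ('a \<times> 'b \<Rightarrow>\<^sub>0 int) set" where
  "coend_right F A n x =
     gfinprod (chains (coend_target F A) n)
       (\<lambda>(s, t). coend_inj F A s n
          (tensor_chain_map (obj F s) (obj A s) (\<lambda>p. id) (mor A s t) n (x (s, t))))
       {(s, t). 0 \<le> s \<and> s \<le> t}"

definition coend :: "'a ch_diagram \<Rightarrow> 'b ch_diagram \<Rightarrow>
    (real \<Rightarrow> nat \<times> nat \<Rightarrow> ('a \<times> 'b \<Rightarrow>\<^sub>0 int) set) set complex_data" where
  "coend F A =
     coequaliser (coend_source F A) (coend_target F A) (coend_left F A) (coend_right F A)"

text \<open>The map \<open>coend F A \<rightarrow> coend F B\<close> induced by a natural transformation \<open>\<tau> : A \<Rightarrow> B\<close>.\<close>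
definition coend_map :: "'a ch_diagram \<Rightarrow> 'c ch_diagram \<Rightarrow> (real \<Rightarrow> nat \<Rightarrow> 'b \<Rightarrow> 'c) \<Rightarrow> nat \<Rightarrow>
    (real \<Rightarrow> nat \<times> nat \<Rightarrow> ('a \<times> 'b \<Rightarrow>\<^sub>0 int) set) set \<Rightarrow>
    (real \<Rightarrow> nat \<times> nat \<Rightarrow> ('a \<times> 'c \<Rightarrow>\<^sub>0 int) set) set" where
  "coend_map F B \<tau> n =
     quot_map (chains (coend_target F B) n)
       (coeq_subgroup (coend_source F B) (coend_target F B) (coend_left F B) (coend_right F B) n)
       (\<lambda>x. \<lambda>s\<in>{0..}. tensor_chain_map (obj F s) (obj B s) (\<lambda>p. id) (\<tau> s) n (x s))"


section \<open>The enriched nerve and its chain complexes\<close>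

text \<open>
  Simplicial sets (with levels of type \<^typ>\<open>'e set\<close>) and simplicial groups (with levels of type
  \<^typ>\<open>'e monoid\<close>). Here \<open>face S n i\<close> goes from level \<open>n + 1\<close> to level \<open>n\<close>, for \<open>i \<le> n + 1\<close>, and
  \<open>degen S n i\<close> goes from level \<open>n\<close> to level \<open>n + 1\<close>, for \<open>i \<le> n\<close>.
\<close>
record ('c, 'e) simplicial =
  level :: "nat \<Rightarrow> 'c"
  face :: "nat \<Rightarrow> nat \<Rightarrow> 'e \<Rightarrow> 'e"
  degen :: "nat \<Rightarrow> nat \<Rightarrow> 'e \<Rightarrow> 'e"

definition nerve :: "'x set \<Rightarrow> ('x \<Rightarrow> 'x \<Rightarrow> real) \<Rightarrow>
    (('x list set, 'x list) simplicial, nat \<Rightarrow> 'x list \<Rightarrow> 'x list) diagram" where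
  "nerve X d =
     \<lparr>obj = (\<lambda>s. \<lparr>level = (\<lambda>n. {xs \<in> tuples X n. tuple_length d xs \<le> s}),
                 face = (\<lambda>n. delete_entry), degen = (\<lambda>n. repeat_entry)\<rparr>),
      mor = (\<lambda>s t n xs. xs)\<rparr>"

definition free_map :: "('a \<Rightarrow> 'b) \<Rightarrow> ('a \<Rightarrow>\<^sub>0 int) \<Rightarrow> ('b \<Rightarrow>\<^sub>0 int)" where
  "free_map f = frag_extend (\<lambda>x. frag_of (f x))"

definition free_simplicial ::
    "('a set, 'a) simplicial \<Rightarrow> (('a \<Rightarrow>\<^sub>0 int) monoid, 'a \<Rightarrow>\<^sub>0 int) simplicial" where
  "free_simplicial S =
     \<lparr>level = (\<lambda>n. free_Abelian_group (level S n)),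
      face = (\<lambda>n i. free_map (face S n i)),
      degen = (\<lambda>n i. free_map (degen S n i))\<rparr>"

definition unnormalised :: "('a monoid, 'a) simplicial \<Rightarrow> 'a complex_data" where
  "unnormalised S =
     \<lparr>chains = level S,
      bdry = (\<lambda>n x. finprod (level S n)
        (\<lambda>i. face S n i x [^]\<^bsub>level S n\<^esub> ((-1) ^ i :: int)) {..Suc n})\<rparr>"

definition CN :: "'x set \<Rightarrow> ('x \<Rightarrow> 'x \<Rightarrow> real) \<Rightarrow> ('x list \<Rightarrow>\<^sub>0 int) ch_diagram" where
  "CN X d =
     \<lparr>obj = (\<lambda>s. unnormalised (free_simplicial (obj (nerve X d) s))),
      mor = (\<lambda>s t n. free_map (mor (nerve X d) s t n))\<rparr>"


section \<open>The coefficient functors\<close>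

definition coeff :: "real \<Rightarrow> int ab_diagram" where
  "coeff e =
     \<lparr>obj = (\<lambda>l. if l = e then integer_group else singleton_group 0),
      mor = (\<lambda>l l'. if l = e \<and> l' = e then id else (\<lambda>k. 0))\<rparr>"

definition coeff_trans :: "real \<Rightarrow> real \<Rightarrow> real \<Rightarrow> int \<Rightarrow> int" where
  "coeff_trans e e' l = (if l = e \<and> e = e' then id else (\<lambda>k. 0))"

definition CN_coend_coeff :: "'x set \<Rightarrow> ('x \<Rightarrow> 'x \<Rightarrow> real) \<Rightarrow>
    (real \<Rightarrow> nat \<times> nat \<Rightarrow> (('x list \<Rightarrow>\<^sub>0 int) \<times> int \<Rightarrow>\<^sub>0 int) set) set ch_diagram" where
  "CN_coend_coeff X d =
     \<lparr>obj = (\<lambda>e. coend (CN X d) (concentrated_cofunctor (coeff e))),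
      mor = (\<lambda>e e'. coend_map (CN X d) (concentrated_cofunctor (coeff e'))
        (\<lambda>l. concentrated_map (obj (coeff e') l) (coeff_trans e e' l)))\<rparr>"


section \<open>The magnitude complex\<close>

text \<open>The face \<open>d\<^sup>i\<^sub>n\<close> on a tuple \<open>xs = (x\<^sub>0, \<dots>, x\<^sub>n)\<close>, for \<open>n \<ge> 1\<close> and \<open>i \<le> n\<close>.\<close>
definition magnitude_face :: "('x \<Rightarrow> 'x \<Rightarrow> real) \<Rightarrow> nat \<Rightarrow> nat \<Rightarrow> 'x list \<Rightarrow> ('x list \<Rightarrow>\<^sub>0 int)" where
  "magnitude_face d n i xs =
     (if (if i = 0 then d (xs ! 0) (xs ! 1) = 0
          else if i = n then d (xs ! (n - 1)) (xs ! n) = 0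
          else d (xs ! (i - 1)) (xs ! i) + d (xs ! i) (xs ! (i + 1)) = d (xs ! (i - 1)) (xs ! (i + 1)))
      then frag_of (delete_entry i xs) else 0)"

text \<open>
  A \<open>[0, \<infinity>)\<close>-graded object is the family of its homogeneous parts, so \<open>obj (magnitude X d) l\<close> is the
  degree-\<open>l\<close> part of the complex.
\<close>
definition magnitude :: "'x set \<Rightarrow> ('x \<Rightarrow> 'x \<Rightarrow> real) \<Rightarrow> ('x list \<Rightarrow>\<^sub>0 int) ch_diagram" where
  "magnitude X d =
     \<lparr>obj = (\<lambda>l. \<lparr>chains = (\<lambda>n. free_Abelian_group {xs \<in> tuples X n. tuple_length d xs = l}),
        bdry = (\<lambda>n. frag_extend (\<lambda>xs. \<Sum>i\<le>Suc n. frag_cmul ((-1) ^ i) (magnitude_face d (Suc n) i xs)))\<rparr>),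
      mor = (\<lambda>l l' n. if l = l' then id else (\<lambda>x. 0))\<rparr>"

end

theory Submission
  imports Defs
begin

text \<open>
  Fix a length \<open>e\<close>. The coefficient functor \<open>A\<^sub>e\<close> vanishes away from \<open>e\<close>, so the only summand of
  \<open>\<Oplus>\<^sub>l CN(X)(l) \<boxtimes> A\<^sub>e(l)\<close> that survives is \<open>CN(X)(e) \<boxtimes> \<int>\<close>, which is \<open>CN(X)(e)\<close> itself
  through \<open>x \<mapsto> x \<boxtimes> 1\<close> (\<open>target_cases\<close>). The coend is therefore a quotient of \<open>CN(X)(e)\<close>. A summand
  \<open>CN(X)(s) \<boxtimes> A\<^sub>e(t)\<close> of the source of the two coequalised maps is nonzero only for \<open>t = e\<close>. For
  \<open>s = e\<close> the two maps agree on it. For \<open>s < e\<close> one of them is the inclusion of \<open>CN(X)(s)\<close> into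
  \<open>CN(X)(e)\<close> and the other factors through \<open>A\<^sub>e(s) = 0\<close>. So exactly the chains on tuples of length at
  most \<open>s\<close>, for all \<open>s < e\<close>, are divided out; these are the chains on tuples of length less than
  \<open>e\<close>, and the quotient is free on the tuples of length exactly \<open>e\<close>.
  
  The differential also matches. Deleting an entry shortens a tuple by a defect that is nonnegative
  by the triangle inequality, and a face of a tuple of length \<open>e\<close> survives in the quotient if and
  only if its defect is zero, which is the condition in the definition of \<open>M(X)\<close>.
  
  In the formal proof both steps are one map: \<open>coend_proj\<close> reads off \<open>x\<close> from \<open>x \<boxtimes> 1\<close> and keeps the
  part of \<open>x\<close> on tuples of length \<open>e\<close>. It is a surjective chain map (\<open>exact_length_part_bdry\<close>) whose
  kernel is the image of the difference of the two maps (\<open>kernel_coend_proj\<close>), so the first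
  isomorphism theorem gives the isomorphism of complexes (\<open>coequaliser_iso\<close>). Naturality says that
  both functors send \<open>e < e'\<close> to zero. Functoriality of the coend and \<open>\<partial>\<partial> = 0\<close> for it are transported
  from \<open>M(X)\<close> along the isomorphism, and \<open>M(X)\<close> in turn inherits \<open>\<partial>\<partial> = 0\<close> from \<open>CN(X)\<close>. The
  statement about homology holds because homology is a functor
  (\<open>ab_naturally_isomorphic_homology\<close>).
\<close>

section \<open>Homomorphisms on quotients and on direct sums\<close>

text \<open>
  Elementwise \<open>n (f (k x)) = (n (f k)) (f x)\<close> with \<open>f k \<in> N\<close>, so the defining product of sets is a single
  coset.
\<close>
lemma quot_map_rcoset:
  assumes "group G" "group H" and f: "f \<in> hom G H" and K: "subgroup K G" and N: "subgroup N H"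
    and sub: "f ` K \<subseteq> N" and x: "x \<in> carrier G"
  shows "quot_map H N f (K #>\<^bsub>G\<^esub> x) = N #>\<^bsub>H\<^esub> f x"
proof -
  interpret G: group G by fact
  interpret H: group H by fact
  interpret K: subgroup K G by fact
  interpret N: subgroup N H by fact
  interpret f: group_hom G H f by unfold_locales (fact f)
  have "n \<otimes>\<^bsub>H\<^esub> f (k \<otimes>\<^bsub>G\<^esub> x) = (n \<otimes>\<^bsub>H\<^esub> f k) \<otimes>\<^bsub>H\<^esub> f x" if "n \<in> N" "k \<in> K" for n k
    using that x by (simp add: H.m_assoc)
  moreover have "n \<otimes>\<^bsub>H\<^esub> f k \<in> N" if "n \<in> N" "k \<in> K" for n k
    using that sub by auto
  ultimately have "quot_map H N f (K #>\<^bsub>G\<^esub> x) \<subseteq> N #>\<^bsub>H\<^esub> f x"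
    by (fastforce simp: quot_map_def set_mult_def r_coset_def)
  moreover have "n \<otimes>\<^bsub>H\<^esub> f x = n \<otimes>\<^bsub>H\<^esub> f (\<one>\<^bsub>G\<^esub> \<otimes>\<^bsub>G\<^esub> x)" for n
    using x by simp
  then have "N #>\<^bsub>H\<^esub> f x \<subseteq> quot_map H N f (K #>\<^bsub>G\<^esub> x)"
    using K.one_closed unfolding quot_map_def set_mult_def r_coset_def by blast
  ultimately show ?thesis ..
qed

lemma image_rcoset_eq_singleton:
  assumes "group G" "group H" and f: "f \<in> hom G H" and K: "subgroup K G"
    and sub: "f ` K \<subseteq> {\<one>\<^bsub>H\<^esub>}" and x: "x \<in> carrier G"
  shows "f ` (K #>\<^bsub>G\<^esub> x) = {f x}"
proof -
  interpret G: group G by fact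
  interpret H: group H by fact
  interpret K: subgroup K G by fact
  interpret f: group_hom G H f by unfold_locales (fact f)
  have eq: "f (k \<otimes>\<^bsub>G\<^esub> x) = f x" if "k \<in> K" for k
  proof -
    have "f k = \<one>\<^bsub>H\<^esub>"
      using that sub by blast
    then show ?thesis
      using that x f.hom_mult [of k x] by simp
  qed
  then have "f ` (K #>\<^bsub>G\<^esub> x) \<subseteq> {f x}"
    by (auto simp: r_coset_def)
  moreover have "f x \<in> f ` (K #>\<^bsub>G\<^esub> x)"
    using x K by (simp add: G.rcos_self)
  ultimately show ?thesis
    by blast
qed

lemma hom_FactGroupI:
  assumes K: "K \<lhd> G" and f: "f \<in> hom G H"
    and F: "\<And>x. x \<in> carrier G \<Longrightarrow> F (K #>\<^bsub>G\<^esub> x) = f x"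
  shows "F \<in> hom (G Mod K) H"
proof (rule homI)
  interpret normal K G by fact
  show "F c \<in> carrier H" if "c \<in> carrier (G Mod K)" for c
    using that F hom_in_carrier [OF f] by (auto simp: carrier_FactGroup)
  show "F (c \<otimes>\<^bsub>G Mod K\<^esub> c') = F c \<otimes>\<^bsub>H\<^esub> F c'"
    if "c \<in> carrier (G Mod K)" "c' \<in> carrier (G Mod K)" for c c'
    using that hom_mult [OF f] by (auto simp: carrier_FactGroup rcos_sum F)
qed

text \<open>
  Homomorphy can be tested after precomposition with a surjective homomorphism, so an explicit
  formula on a family of representatives is enough.
\<close>
lemma hom_if_hom_on_representatives:
  assumes "group A" and p: "p \<in> hom A B" and surj: "p ` carrier A = carrier B"
    and h: "h \<in> hom A C" and f: "\<And>a. a \<in> carrier A \<Longrightarrow> f (p a) = h a"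
  shows "f \<in> hom B C"
proof (rule homI)
  interpret A: group A by fact
  show "f b \<in> carrier C" if "b \<in> carrier B" for b
    using that f hom_in_carrier [OF h] unfolding surj [symmetric] by auto
  show "f (b \<otimes>\<^bsub>B\<^esub> b') = f b \<otimes>\<^bsub>C\<^esub> f b'" if "b \<in> carrier B" "b' \<in> carrier B" for b b'
  proof -
    have "b \<in> p ` carrier A" "b' \<in> p ` carrier A"
      using that surj by simp_all
    then obtain a a' where a: "a \<in> carrier A" "a' \<in> carrier A" and b: "b = p a" "b' = p a'"
      by (elim imageE)
    have "f (b \<otimes>\<^bsub>B\<^esub> b') = f (p (a \<otimes>\<^bsub>A\<^esub> a'))"
      using a b by (simp add: hom_mult [OF p])
    also have "\<dots> = f b \<otimes>\<^bsub>C\<^esub> f b'"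
      using a b by (simp add: f hom_mult [OF h])
    finally show ?thesis .
  qed
qed

lemma comm_group_sum_group:
  assumes "\<And>i. i \<in> I \<Longrightarrow> comm_group (G i)"
  shows "comm_group (sum_group I G)"
proof (rule group.group_comm_groupI)
  have grp: "\<And>i. i \<in> I \<Longrightarrow> group (G i)"
    using assms by (simp add: comm_group_def)
  then show "group (sum_group I G)"
    by simp
  show "x \<otimes>\<^bsub>sum_group I G\<^esub> y = y \<otimes>\<^bsub>sum_group I G\<^esub> x"
    if "x \<in> carrier (sum_group I G)" "y \<in> carrier (sum_group I G)" for x y
    using that by (auto simp: carrier_sum_group [OF grp] PiE_iff
        intro!: restrict_ext comm_monoid.m_comm [OF comm_group.axioms(1) [OF assms]])
qed

lemma sum_inj_hom:
  assumes grp: "\<And>i. i \<in> I \<Longrightarrow> group (G i)" and j: "j \<in> I"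
  shows "sum_inj I G j \<in> hom (G j) (sum_group I G)"
proof (rule homI)
  show "sum_inj I G j x \<in> carrier (sum_group I G)" if "x \<in> carrier (G j)" for x
  proof -
    have "finite {i \<in> I. sum_inj I G j x i \<noteq> \<one>\<^bsub>G i\<^esub>}"
      by (rule finite_subset [of _ "{j}"]) (auto simp: sum_inj_def)
    then show ?thesis
      using that by (auto simp: carrier_sum_group [OF grp] sum_inj_def group.is_monoid grp)
  qed
qed (auto simp: sum_inj_def group.is_monoid grp)

lemma sum_component_hom:
  assumes grp: "\<And>i. i \<in> I \<Longrightarrow> group (G i)" and j: "j \<in> I"
  shows "(\<lambda>x. x j) \<in> hom (sum_group I G) (G j)"
  using j by (auto simp: hom_def carrier_sum_group [OF grp])

lemma hom_finite_sum_groupI: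
  assumes "finite I" and grp: "\<And>i. i \<in> I \<Longrightarrow> group (G i)"
    and f: "\<And>i. i \<in> I \<Longrightarrow> f i \<in> hom A (G i)"
  shows "(\<lambda>x. \<lambda>i\<in>I. f i x) \<in> hom A (sum_group I G)"
  using assms hom_in_carrier [OF f] hom_mult [OF f]
  by (auto simp: hom_def [of A "sum_group I G"] carrier_sum_group [OF grp])

lemma sum_inj_if_one_elsewhere:
  assumes grp: "\<And>i. i \<in> I \<Longrightarrow> group (G i)" and x: "x \<in> carrier (sum_group I G)" and j: "j \<in> I"
    and one: "\<And>i. i \<in> I \<Longrightarrow> i \<noteq> j \<Longrightarrow> x i = \<one>\<^bsub>G i\<^esub>"
  shows "x = sum_inj I G j (x j)"
  using x one j by (auto simp: sum_inj_def carrier_sum_group [OF grp] PiE_iff extensional_def)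

text \<open>
  Elements of a direct sum have finite support, so they are generated by the images of the
  injections: the induction splits off one component at a time.
\<close>
lemma sum_group_hom_eqI:
  assumes grp: "\<And>i. i \<in> I \<Longrightarrow> group (G i)" and "group H"
    and u: "u \<in> hom (sum_group I G) H" and v: "v \<in> hom (sum_group I G) H"
    and eq: "\<And>i y. i \<in> I \<Longrightarrow> y \<in> carrier (G i) \<Longrightarrow> u (sum_inj I G i y) = v (sum_inj I G i y)"
    and x: "x \<in> carrier (sum_group I G)"
  shows "u x = v x"
proof -
  have "u x = v x" if "finite F" "x \<in> carrier (sum_group I G)" "{i \<in> I. x i \<noteq> \<one>\<^bsub>G i\<^esub>} \<subseteq> F" for F x
    using that
  proof (induction F arbitrary: x rule: finite_induct)
    case empty
    then have "x = \<one>\<^bsub>sum_group I G\<^esub>"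
      by (auto simp: carrier_sum_group [OF grp] PiE_iff extensional_def)
    then show ?case
      using hom_one [OF u] hom_one [OF v] \<open>group H\<close> grp sum_group by metis
  next
    case (insert j F)
    show ?case
    proof (cases "j \<in> I")
      case False
      then show ?thesis
        using insert by blast
    next
      case True
      define y where "y = (\<lambda>i\<in>I. if i = j then \<one>\<^bsub>G i\<^esub> else x i)"
      have xi: "x i \<in> carrier (G i)" if "i \<in> I" for i
        using insert.prems that by (auto simp: carrier_sum_group [OF grp])
      have supp: "{i \<in> I. y i \<noteq> \<one>\<^bsub>G i\<^esub>} \<subseteq> F"
        using insert.prems by (auto simp: y_def)
      have y: "y \<in> carrier (sum_group I G)"
        using finite_subset [OF supp \<open>finite F\<close>] xi
        by (auto simp: carrier_sum_group [OF grp] y_def group.is_monoid grp)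
      have inj: "sum_inj I G j (x j) \<in> carrier (sum_group I G)"
        using hom_in_carrier [OF sum_inj_hom [of I G, OF grp True] xi [OF True]] .
      have "x = sum_inj I G j (x j) \<otimes>\<^bsub>sum_group I G\<^esub> y"
      proof
        show "x i = (sum_inj I G j (x j) \<otimes>\<^bsub>sum_group I G\<^esub> y) i" for i
          using insert.prems(1) xi
          by (auto simp: sum_inj_def y_def carrier_sum_group [OF grp] PiE_iff extensional_def
              grp group.is_monoid)
      qed
      then show ?thesis
        using hom_mult [OF u inj y] hom_mult [OF v inj y] eq [OF True xi [OF True]]
          insert.IH [OF y supp] by simp
    qed
  qed
  then show ?thesis
    using x by (auto simp: carrier_sum_group [OF grp])
qed

lemma gfinprod_sum_inj:
  assumes "comm_group H" and grp: "\<And>i. i \<in> I \<Longrightarrow> group (G i)"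
    and h: "\<And>i. i \<in> I \<Longrightarrow> h i \<in> hom (G i) H" and j: "j \<in> I" and y: "y \<in> carrier (G j)"
  shows "gfinprod H (\<lambda>i. h i (sum_inj I G j y i)) I = h j y"
proof -
  interpret H: comm_group H by fact
  have one: "h i (sum_inj I G j y i) = \<one>\<^bsub>H\<^esub>" if "i \<in> I" "i \<noteq> j" for i
    using that hom_one [OF h] grp H.is_group by (simp add: sum_inj_def)
  have hy: "h j (sum_inj I G j y j) = h j y" "h j y \<in> carrier H"
    using j hom_in_carrier [OF h [OF j] y] by (simp_all add: sum_inj_def)
  have "gfinprod H (\<lambda>i. h i (sum_inj I G j y i)) I = gfinprod H (\<lambda>i. h j y) {j}"
    by (rule H.gfinprod_mono_neutral_cong_right)
      (use j one hy in \<open>auto simp: Pi_iff\<close>, metis H.one_closed)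
  also have "\<dots> = h j y"
    using hy by (subst H.gfinprod_eq_finprod) (auto simp: H.finprod_singleton)
  finally show ?thesis .
qed

section \<open>Tensor products\<close>

abbreviation pure_tensor :: "'a monoid \<Rightarrow> 'b monoid \<Rightarrow> 'a \<Rightarrow> 'b \<Rightarrow> ('a \<times> 'b \<Rightarrow>\<^sub>0 int) set" where
  "pure_tensor G H x y \<equiv>
     tensor_subgroup G H #>\<^bsub>free_Abelian_group (carrier G \<times> carrier H)\<^esub> frag_of (x, y)"

lemma
  shows tensor_relations_left: "\<lbrakk>x \<in> carrier G; x' \<in> carrier G; y \<in> carrier H\<rbrakk> \<Longrightarrow>
      frag_of (x \<otimes>\<^bsub>G\<^esub> x', y) - frag_of (x, y) - frag_of (x', y) \<in> tensor_relations G H"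
    and tensor_relations_right: "\<lbrakk>x \<in> carrier G; y \<in> carrier H; y' \<in> carrier H\<rbrakk> \<Longrightarrow>
      frag_of (x, y \<otimes>\<^bsub>H\<^esub> y') - frag_of (x, y) - frag_of (x, y') \<in> tensor_relations G H"
  unfolding tensor_relations_def by blast+

lemma tensor_relations_in_carrier:
  assumes "group G" "group H"
  shows "tensor_relations G H \<subseteq> carrier (free_Abelian_group (carrier G \<times> carrier H))"
proof -
  interpret G: group G by fact
  interpret H: group H by fact
  have diff: "frag_of a - frag_of b - frag_of c \<in> carrier (free_Abelian_group S)"
    if "a \<in> S" "b \<in> S" "c \<in> S" for a b c :: "'a \<times> 'b" and S
    using that keys_diff [of "frag_of a - frag_of b" "frag_of c"] keys_diff [of "frag_of a" "frag_of b"]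
    by auto
  show ?thesis
    unfolding tensor_relations_def by (intro Un_least subsetI; clarify; rule diff; simp)
qed

lemma tensor_subgroup_normal:
  assumes "group G" "group H"
  shows "tensor_subgroup G H \<lhd> free_Abelian_group (carrier G \<times> carrier H)"
  unfolding tensor_subgroup_def
  by (intro comm_group.subgroup_imp_normal abelian_free_Abelian_group group.generate_is_subgroup
      group_free_Abelian_group tensor_relations_in_carrier assms)

lemmas tensor_subgroup_subgroup = normal_imp_subgroup [OF tensor_subgroup_normal]

lemma tensor_group_comm_group:
  assumes "group G" "group H"
  shows "comm_group (tensor_group G H)"
  unfolding tensor_group_def
  by (intro comm_group.abelian_FactGroup abelian_free_Abelian_group tensor_subgroup_subgroup assms)

lemma tensor_group_group:
  assumes "group G" "group H"
  shows "group (tensor_group G H)"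
  using tensor_group_comm_group [OF assms] by (simp add: comm_group_def)

lemma rcoset_hom_tensor_group:
  assumes "group G" "group H"
  shows "(\<lambda>c. tensor_subgroup G H #>\<^bsub>free_Abelian_group (carrier G \<times> carrier H)\<^esub> c)
           \<in> hom (free_Abelian_group (carrier G \<times> carrier H)) (tensor_group G H)"
  unfolding tensor_group_def by (rule normal.r_coset_hom_Mod [OF tensor_subgroup_normal [OF assms]])

lemma pure_tensor_in_carrier:
  assumes "group G" "group H" "x \<in> carrier G" "y \<in> carrier H"
  shows "pure_tensor G H x y \<in> carrier (tensor_group G H)"
  using hom_in_carrier [OF rcoset_hom_tensor_group [OF assms(1,2)]] assms by simp

text \<open>
  The cosets of the generators satisfy the bilinearity relations because the differences of both
  sides are among the relations divided out.
\<close>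
lemma
  assumes grp: "group G" "group H"
  shows pure_tensor_hom_left: "y \<in> carrier H \<Longrightarrow> (\<lambda>x. pure_tensor G H x y) \<in> hom G (tensor_group G H)"
    and pure_tensor_hom_right: "x \<in> carrier G \<Longrightarrow> pure_tensor G H x \<in> hom H (tensor_group G H)"
proof -
  interpret G: group G by fact
  interpret H: group H by fact
  let ?F = "free_Abelian_group (carrier G \<times> carrier H)"
  let ?c = "\<lambda>c. tensor_subgroup G H #>\<^bsub>?F\<^esub> c"
  interpret K: normal "tensor_subgroup G H" ?F
    by (rule tensor_subgroup_normal [OF grp])
  have rel: "?c (frag_of a) = ?c (frag_of b) \<otimes>\<^bsub>tensor_group G H\<^esub> ?c (frag_of b')"
    if mem: "a \<in> carrier G \<times> carrier H" "b \<in> carrier G \<times> carrier H" "b' \<in> carrier G \<times> carrier H"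
      and r: "frag_of a - frag_of b - frag_of b' \<in> tensor_relations G H" for a b b'
  proof -
    have "frag_of a - frag_of b - frag_of b' \<in> tensor_subgroup G H"
      unfolding tensor_subgroup_def using r by (rule generate.incl)
    then have "frag_of a \<in> tensor_subgroup G H #>\<^bsub>?F\<^esub> (frag_of b + frag_of b')"
      unfolding r_coset_def
      by (force intro: bexI [of _ "frag_of a - frag_of b - frag_of b'"])
    moreover have sum: "frag_of b + frag_of b' \<in> carrier ?F"
      using mem keys_add [of "frag_of b" "frag_of b'"] by auto
    ultimately have "?c (frag_of a) = ?c (frag_of b + frag_of b')"
      by (metis K.repr_independence K.subgroup_axioms)
    also have "\<dots> = ?c (frag_of b) \<otimes>\<^bsub>tensor_group G H\<^esub> ?c (frag_of b')"
      using hom_mult [OF rcoset_hom_tensor_group [OF grp]] mem by simp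
    finally show ?thesis .
  qed
  show "(\<lambda>x. pure_tensor G H x y) \<in> hom G (tensor_group G H)" if y: "y \<in> carrier H"
    by (intro homI rel pure_tensor_in_carrier grp tensor_relations_left) (use y in auto)
  show "pure_tensor G H x \<in> hom H (tensor_group G H)" if x: "x \<in> carrier G"
    by (intro homI rel pure_tensor_in_carrier grp tensor_relations_right) (use x in auto)
qed

text \<open>
  The induction predicate is a subgroup, so that it is enough to treat the generators.
\<close>
lemma tensor_group_induct:
  assumes grp: "group G" "group H" and w: "w \<in> carrier (tensor_group G H)"
    and sub: "subgroup P (tensor_group G H)"
    and pure: "\<And>x y. x \<in> carrier G \<Longrightarrow> y \<in> carrier H \<Longrightarrow> pure_tensor G H x y \<in> P"
  shows "w \<in> P"
proof -
  let ?F = "free_Abelian_group (carrier G \<times> carrier H)"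
  let ?c = "\<lambda>c. tensor_subgroup G H #>\<^bsub>?F\<^esub> c"
  note T = tensor_group_group [OF grp]
  note hom = rcoset_hom_tensor_group [OF grp]
  interpret c: group_hom ?F "tensor_group G H" ?c
    by (intro group_hom.intro group_hom_axioms.intro group_free_Abelian_group T hom)
  interpret P: subgroup P "tensor_group G H" by fact
  obtain c where c: "Poly_Mapping.keys c \<subseteq> carrier G \<times> carrier H" and w: "w = ?c c"
    using w by (auto simp: tensor_group_def carrier_FactGroup)
  have "?c c \<in> P"
  proof (rule free_Abelian_group_induct [OF c])
    show "?c 0 \<in> P"
      using P.one_closed c.hom_one by simp
    show "?c (x - y) \<in> P"
      if "Poly_Mapping.keys x \<subseteq> carrier G \<times> carrier H" "Poly_Mapping.keys y \<subseteq> carrier G \<times> carrier H"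
        "?c x \<in> P" "?c y \<in> P" for x y
    proof -
      have "?c (x - y) = ?c x \<otimes>\<^bsub>tensor_group G H\<^esub> inv\<^bsub>tensor_group G H\<^esub> ?c y"
        using that c.hom_mult [of x "- y"] c.hom_inv [of y] by simp
      then show ?thesis
        using that by auto
    qed
    show "?c (frag_of a) \<in> P" if "a \<in> carrier G \<times> carrier H" for a
      using that pure by auto
  qed
  then show ?thesis
    using w by simp
qed

lemma frag_extend_hom:
  assumes "\<And>a. a \<in> S \<Longrightarrow> Poly_Mapping.keys (b a) \<subseteq> T"
  shows "frag_extend b \<in> hom (free_Abelian_group S) (free_Abelian_group T)"
proof (rule homI)
  show "frag_extend b c \<in> carrier (free_Abelian_group T)" if "c \<in> carrier (free_Abelian_group S)" for c
    using that assms
    by (auto intro!: order.trans [OF keys_frag_extend] simp del: UN_subset_iff intro!: UN_least)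
qed (simp add: frag_extend_add)

context
  fixes G :: "'a monoid" and H :: "'b monoid" and G' :: "'c monoid" and H' :: "'d monoid"
    and f :: "'a \<Rightarrow> 'c" and g :: "'b \<Rightarrow> 'd"
  assumes grp: "group G" "group H" "group G'" "group H'"
    and f: "f \<in> hom G G'" and g: "g \<in> hom H H'"
begin

text \<open>
  A product of homomorphisms maps each bilinearity relation to a bilinearity relation, hence the
  subgroup of relations into that of the codomain, and the induced map is well defined on cosets.
\<close>
lemma tensor_map_rcoset:
  assumes c: "Poly_Mapping.keys c \<subseteq> carrier G \<times> carrier H"
  shows "tensor_map G' H' f g (tensor_subgroup G H #>\<^bsub>free_Abelian_group (carrier G \<times> carrier H)\<^esub> c) =
    tensor_subgroup G' H' #>\<^bsub>free_Abelian_group (carrier G' \<times> carrier H')\<^esub>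
      frag_extend (\<lambda>(x, y). frag_of (f x, g y)) c"
  unfolding tensor_map_def
proof (rule quot_map_rcoset)
  let ?F = "free_Abelian_group (carrier G \<times> carrier H)"
  let ?F' = "free_Abelian_group (carrier G' \<times> carrier H')"
  let ?m = "frag_extend (\<lambda>(x, y). frag_of (f x, g y))"
  show m: "?m \<in> hom ?F ?F'"
    by (rule frag_extend_hom) (use hom_in_carrier [OF f] hom_in_carrier [OF g] in auto)
  interpret m: group_hom ?F ?F' ?m
    by (intro group_hom.intro group_hom_axioms.intro group_free_Abelian_group m)
  have "?m ` tensor_relations G H \<subseteq> tensor_relations G' H'"
  proof -
    have "?m (frag_of (x \<otimes>\<^bsub>G\<^esub> x', y) - frag_of (x, y) - frag_of (x', y)) \<in> tensor_relations G' H'"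
      if "x \<in> carrier G" "x' \<in> carrier G" "y \<in> carrier H" for x x' y
      using that hom_in_carrier [OF f] hom_in_carrier [OF g]
      by (simp add: frag_extend_diff hom_mult [OF f] tensor_relations_left)
    moreover have "?m (frag_of (x, y \<otimes>\<^bsub>H\<^esub> y') - frag_of (x, y) - frag_of (x, y')) \<in> tensor_relations G' H'"
      if "x \<in> carrier G" "y \<in> carrier H" "y' \<in> carrier H" for x y y'
      using that hom_in_carrier [OF f] hom_in_carrier [OF g]
      by (simp add: frag_extend_diff hom_mult [OF g] tensor_relations_right)
    ultimately show ?thesis
      unfolding tensor_relations_def [of G H] by blast
  qed
  then show "?m ` tensor_subgroup G H \<subseteq> tensor_subgroup G' H'"
    unfolding tensor_subgroup_def
    using m.generate_img [OF tensor_relations_in_carrier [OF grp(1,2)]] m.H.mono_generate by metis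
qed (use grp c in \<open>simp_all add: tensor_subgroup_subgroup\<close>)

lemma tensor_map_pure_tensor:
  "x \<in> carrier G \<Longrightarrow> y \<in> carrier H \<Longrightarrow>
    tensor_map G' H' f g (pure_tensor G H x y) = pure_tensor G' H' (f x) (g y)"
  by (subst tensor_map_rcoset) auto

lemma tensor_map_hom: "tensor_map G' H' f g \<in> hom (tensor_group G H) (tensor_group G' H')"
  unfolding tensor_group_def [of G H]
proof (rule hom_FactGroupI)
  show "tensor_subgroup G H \<lhd> free_Abelian_group (carrier G \<times> carrier H)"
    using grp by (simp add: tensor_subgroup_normal)
  have "frag_extend (\<lambda>(x, y). frag_of (f x, g y)) \<in>
      hom (free_Abelian_group (carrier G \<times> carrier H)) (free_Abelian_group (carrier G' \<times> carrier H'))"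
    by (rule frag_extend_hom) (use hom_in_carrier [OF f] hom_in_carrier [OF g] in auto)
  then show "(\<lambda>c. tensor_subgroup G' H' #>\<^bsub>free_Abelian_group (carrier G' \<times> carrier H')\<^esub> c) \<circ>
      frag_extend (\<lambda>(x, y). frag_of (f x, g y))
      \<in> hom (free_Abelian_group (carrier G \<times> carrier H)) (tensor_group G' H')"
    by (rule hom_compose [OF _ rcoset_hom_tensor_group [OF grp(3,4)]])
qed (simp add: tensor_map_rcoset)

end

text \<open>
  \<open>y \<mapsto> x \<boxtimes> y\<close> is a homomorphism, so it sends the neutral element \<open>a\<close> to the neutral element.
\<close>
lemma tensor_group_trivial:
  assumes grp: "group G" and w: "w \<in> carrier (tensor_group G (singleton_group a))"
  shows "w = \<one>\<^bsub>tensor_group G (singleton_group a)\<^esub>"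
proof -
  let ?T = "tensor_group G (singleton_group a)"
  have T: "group ?T"
    using grp by (simp add: tensor_group_group)
  have "pure_tensor G (singleton_group a) x y = \<one>\<^bsub>?T\<^esub>"
    if "x \<in> carrier G" "y \<in> carrier (singleton_group a)" for x y
  proof -
    have "\<one>\<^bsub>singleton_group a\<^esub> = y"
      using that by (simp add: singleton_group_def)
    then show ?thesis
      using that hom_one [OF pure_tensor_hom_right [OF grp singleton_group] singleton_group T] by metis
  qed
  then have "w \<in> {\<one>\<^bsub>?T\<^esub>}"
    by (intro tensor_group_induct [OF grp singleton_group w] group.triv_subgroup T) auto
  then show ?thesis
    by simp
qed

text \<open>
  Since \<open>x \<boxtimes> k = x\<^sup>k \<boxtimes> 1\<close> and \<open>x \<mapsto> x \<boxtimes> 1\<close> is a homomorphism, the tensors \<open>x \<boxtimes> 1\<close> form a subgroup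
  that contains all generators.
\<close>
lemma tensor_integer_group_cases:
  assumes grp: "group G" and w: "w \<in> carrier (tensor_group G integer_group)"
  obtains x where "x \<in> carrier G" "w = pure_tensor G integer_group x 1"
proof -
  let ?T = "tensor_group G integer_group"
  interpret G: group G by fact
  interpret T: group ?T
    by (simp add: tensor_group_group grp)
  interpret u: group_hom G ?T "\<lambda>x. pure_tensor G integer_group x 1"
    by unfold_locales (rule pure_tensor_hom_left; simp add: grp)
  have "pure_tensor G integer_group x k \<in> (\<lambda>x. pure_tensor G integer_group x 1) ` carrier G"
    if x: "x \<in> carrier G" for x k
  proof -
    have "pure_tensor G integer_group x k = pure_tensor G integer_group x (1 [^]\<^bsub>integer_group\<^esub> k)"
      by simp
    also have "\<dots> = pure_tensor G integer_group x 1 [^]\<^bsub>?T\<^esub> k"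
      by (rule hom_int_pow [OF pure_tensor_hom_right]) (use x grp in simp_all)
    also have "\<dots> = pure_tensor G integer_group (x [^]\<^bsub>G\<^esub> k) 1"
      by (rule u.hom_int_pow [symmetric]) (fact x)
    finally show ?thesis
      using x by blast
  qed
  then have "w \<in> (\<lambda>x. pure_tensor G integer_group x 1) ` carrier G"
    by (intro tensor_group_induct [OF grp group_integer_group w] u.img_is_subgroup) simp
  then show ?thesis
    using that by blast
qed

text \<open>
  The canonical map \<open>G \<boxtimes> \<int> \<rightarrow> G\<close>, \<open>x \<boxtimes> k \<mapsto> k x\<close>, for a free abelian group \<open>G\<close>. Its lift to formal
  combinations of pairs kills the tensor relations, so it takes a single value on each coset.
\<close>
definition integer_contraction :: "(('a \<Rightarrow>\<^sub>0 int) \<times> int \<Rightarrow>\<^sub>0 int) set \<Rightarrow> ('a \<Rightarrow>\<^sub>0 int)" where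
  "integer_contraction w = the_elem (frag_extend (\<lambda>(x, k). frag_cmul k x) ` w)"

lemma integer_contraction_pure_tensor:
  assumes x: "Poly_Mapping.keys x \<subseteq> S"
  shows "integer_contraction (pure_tensor (free_Abelian_group S) integer_group x 1) = x"
proof -
  let ?G = "free_Abelian_group S"
  let ?F = "free_Abelian_group (carrier ?G \<times> carrier integer_group)"
  let ?m = "frag_extend (\<lambda>(x, k). frag_cmul k x)"
  have m: "?m \<in> hom ?F ?G"
    by (rule frag_extend_hom) (use keys_cmul in auto)
  interpret m: group_hom ?F ?G ?m
    by (intro group_hom.intro group_hom_axioms.intro group_free_Abelian_group m)
  have rel: "tensor_relations ?G integer_group \<subseteq> carrier ?F"
    by (rule tensor_relations_in_carrier) simp_all
  have "?m ` tensor_relations ?G integer_group \<subseteq> {0}"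
    by (auto simp: tensor_relations_def frag_extend_diff frag_cmul_distrib frag_cmul_distrib2)
  then have "?m ` tensor_subgroup ?G integer_group \<subseteq> {\<one>\<^bsub>?G\<^esub>}"
    unfolding tensor_subgroup_def m.generate_img [OF rel, symmetric]
    using m.H.generate_subgroup_incl [OF _ m.H.triv_subgroup] by simp
  then have "?m ` pure_tensor ?G integer_group x 1 = {?m (frag_of (x, 1))}"
    by (intro image_rcoset_eq_singleton [OF _ _ m] tensor_subgroup_subgroup)
       (use x in simp_all)
  then show ?thesis
    by (simp add: integer_contraction_def)
qed

section \<open>Tensor products with a group in degree 0\<close>

lemma finite_bidegrees: "finite (bidegrees n)"
  by (rule finite_subset [of _ "{..n} \<times> {..n}"]) (auto simp: bidegrees_def)

abbreviation tensor_summand ::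
    "'a complex_data \<Rightarrow> 'b complex_data \<Rightarrow> nat \<times> nat \<Rightarrow> ('a \<times> 'b \<Rightarrow>\<^sub>0 int) set monoid" where
  "tensor_summand C D \<equiv> \<lambda>(p, q). tensor_group (chains C p) (chains D q)"

lemma chains_tensor_complex:
  "chains (tensor_complex C D) n = sum_group (bidegrees n) (tensor_summand C D)"
  by (simp add: tensor_complex_def)

lemma tensor_summand_comm_group:
  assumes "\<And>p. group (chains C p)" "\<And>q. group (chains D q)"
  shows "comm_group (tensor_summand C D i)"
  using assms by (cases i) (simp add: tensor_group_comm_group)

lemma tensor_summand_group:
  assumes "\<And>p. group (chains C p)" "\<And>q. group (chains D q)"
  shows "group (tensor_summand C D i)"
  using tensor_summand_comm_group [OF assms] by (simp add: comm_group_def)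

lemma tensor_complex_comm_group:
  assumes "\<And>p. group (chains C p)" "\<And>q. group (chains D q)"
  shows "comm_group (chains (tensor_complex C D) n)"
  unfolding chains_tensor_complex by (intro comm_group_sum_group tensor_summand_comm_group assms)

lemma tensor_complex_group:
  assumes "\<And>p. group (chains C p)" "\<And>q. group (chains D q)"
  shows "group (chains (tensor_complex C D) n)"
  using tensor_complex_comm_group [OF assms] by (simp add: comm_group_def)

lemma tensor_chain_map_hom:
  assumes C: "\<And>p. group (chains C p)" and D: "\<And>q. group (chains D q)"
    and C': "\<And>p. group (chains C' p)" and D': "\<And>q. group (chains D' q)"
    and f: "\<And>p. f p \<in> hom (chains C p) (chains C' p)"
    and g: "\<And>q. g q \<in> hom (chains D q) (chains D' q)"
  shows "tensor_chain_map C' D' f g n \<in>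
           hom (chains (tensor_complex C D) n) (chains (tensor_complex C' D') n)"
proof -
  let ?T = "\<lambda>(p, q). tensor_map (chains C' p) (chains D' q) (f p) (g q)"
  have "(\<lambda>x. \<lambda>i\<in>bidegrees n. (?T i \<circ> (\<lambda>x. x i)) x) \<in>
      hom (chains (tensor_complex C D) n) (chains (tensor_complex C' D') n)"
    unfolding chains_tensor_complex
  proof (rule hom_finite_sum_groupI [OF finite_bidegrees])
    show "?T i \<circ> (\<lambda>x. x i) \<in> hom (sum_group (bidegrees n) (tensor_summand C D)) (tensor_summand C' D' i)"
      if "i \<in> bidegrees n" for i
    proof (rule hom_compose)
      show "(\<lambda>x. x i) \<in> hom (sum_group (bidegrees n) (tensor_summand C D)) (tensor_summand C D i)"
        by (intro sum_component_hom tensor_summand_group C D that)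
      show "?T i \<in> hom (tensor_summand C D i) (tensor_summand C' D' i)"
        by (cases i) (simp add: tensor_map_hom C D C' D' f g)
    qed
  qed (intro tensor_summand_group C' D')
  moreover have "tensor_chain_map C' D' f g n = (\<lambda>x. \<lambda>i\<in>bidegrees n. (?T i \<circ> (\<lambda>x. x i)) x)"
    by (auto simp: tensor_chain_map_def fun_eq_iff)
  ultimately show ?thesis
    by simp
qed

lemma chains_concentrated:
  "chains (concentrated A) q = (if q = 0 then A else singleton_group \<one>\<^bsub>A\<^esub>)"
  by (simp add: concentrated_def)

lemma concentrated_group: "group A \<Longrightarrow> group (chains (concentrated A) q)"
  by (simp add: chains_concentrated)

lemma tensor_complex_trivial:
  assumes C: "\<And>p. group (chains C p)"
    and w: "w \<in> carrier (chains (tensor_complex C (concentrated (singleton_group a))) n)"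
  shows "w = \<one>\<^bsub>chains (tensor_complex C (concentrated (singleton_group a))) n\<^esub>"
proof -
  let ?D = "concentrated (singleton_group a)"
  have D: "chains ?D q = singleton_group a" for q
    by (simp add: chains_concentrated singleton_group_def)
  have grp: "group (tensor_summand C ?D i)" for i
    by (rule tensor_summand_group) (simp_all add: C D)
  have "w i = \<one>\<^bsub>tensor_summand C ?D i\<^esub>" if "i \<in> bidegrees n" for i
  proof -
    have "w i \<in> carrier (tensor_summand C ?D i)"
      using w that by (auto simp: chains_tensor_complex carrier_sum_group [OF grp])
    then show ?thesis
      using tensor_group_trivial [OF C] by (cases i) (simp add: D)
  qed
  moreover have "w i = undefined" if "i \<notin> bidegrees n" for i
    using w that by (cases i) (simp add: chains_tensor_complex carrier_sum_group [OF grp] PiE_iff extensional_def)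
  ultimately have "w i = (\<lambda>i\<in>bidegrees n. \<one>\<^bsub>tensor_summand C ?D i\<^esub>) i" for i
    by (cases "i \<in> bidegrees n") simp_all
  then show ?thesis
    by (simp add: chains_tensor_complex fun_eq_iff)
qed

abbreviation integer_complex :: "int complex_data" where
  "integer_complex \<equiv> concentrated integer_group"

text \<open>
  The canonical isomorphism \<open>C \<rightarrow> C \<boxtimes> \<int>\<close>, \<open>x \<mapsto> x \<boxtimes> 1\<close>, with value in the total degree \<open>n\<close>.
\<close>
definition unit_tensor :: "'a complex_data \<Rightarrow> nat \<Rightarrow> 'a \<Rightarrow> nat \<times> nat \<Rightarrow> ('a \<times> int \<Rightarrow>\<^sub>0 int) set" where
  "unit_tensor C n x = sum_inj (bidegrees n) (tensor_summand C integer_complex) (n, 0)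
     (pure_tensor (chains C n) integer_group x 1)"

context
  fixes C :: "'a complex_data"
  assumes C: "\<And>p. group (chains C p)"
begin

lemma unit_tensor_hom: "unit_tensor C n \<in> hom (chains C n) (chains (tensor_complex C integer_complex) n)"
proof -
  have pure: "(\<lambda>x. pure_tensor (chains C n) integer_group x 1) \<in> hom (chains C n) (tensor_summand C integer_complex (n, 0))"
    using pure_tensor_hom_left [OF C group_integer_group, of 1] by (simp add: chains_concentrated)
  have inj: "sum_inj (bidegrees n) (tensor_summand C integer_complex) (n, 0) \<in>
      hom (tensor_summand C integer_complex (n, 0)) (chains (tensor_complex C integer_complex) n)"
    unfolding chains_tensor_complex
    by (rule sum_inj_hom) (simp_all add: tensor_summand_group C concentrated_group bidegrees_def)
  have "unit_tensor C n = sum_inj (bidegrees n) (tensor_summand C integer_complex) (n, 0) \<circ>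
      (\<lambda>x. pure_tensor (chains C n) integer_group x 1)"
    by (simp add: unit_tensor_def fun_eq_iff)
  then show ?thesis
    using hom_compose [OF pure inj] by metis
qed

text \<open>
  Only the bidegree \<open>(n, 0)\<close> contributes in total degree \<open>n\<close>, because the other summands are
  tensor products with the zero group.
\<close>
lemma unit_tensor_cases:
  assumes w: "w \<in> carrier (chains (tensor_complex C integer_complex) n)"
  obtains x where "x \<in> carrier (chains C n)" "w = unit_tensor C n x"
proof -
  have grp: "group (tensor_summand C integer_complex i)" for i
    by (rule tensor_summand_group) (simp_all add: C concentrated_group)
  have wi: "w i \<in> carrier (tensor_summand C integer_complex i)" if "i \<in> bidegrees n" for i
    using w that by (auto simp: chains_tensor_complex carrier_sum_group [OF grp])
  have n0: "(n, 0) \<in> bidegrees n"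
    by (simp add: bidegrees_def)
  obtain x where x: "x \<in> carrier (chains C n)" and wx: "w (n, 0) = pure_tensor (chains C n) integer_group x 1"
    using wi [OF n0] tensor_integer_group_cases [OF C] by (auto simp: chains_concentrated)
  have "w i = \<one>\<^bsub>tensor_summand C integer_complex i\<^esub>" if i': "i \<in> bidegrees n" "i \<noteq> (n, 0)" for i
  proof -
    obtain p q where i: "i = (p, Suc q)"
      using i' by (cases i; cases "snd i") (auto simp: bidegrees_def)
    show ?thesis
      using wi [OF i'(1)] tensor_group_trivial [OF C] by (simp add: i chains_concentrated)
  qed
  then have "w = unit_tensor C n x"
    unfolding unit_tensor_def wx [symmetric]
    by (intro sum_inj_if_one_elsewhere grp w [unfolded chains_tensor_complex] n0)
  then show ?thesis
    using that x by blast
qed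

lemma unit_tensor_apply:
  "(p, q) \<in> bidegrees n \<Longrightarrow> unit_tensor C n x (p, q) =
     (if q = 0 then pure_tensor (chains C p) integer_group x 1
      else \<one>\<^bsub>tensor_group (chains C p) (chains integer_complex q)\<^esub>)"
  by (auto simp: unit_tensor_def sum_inj_def bidegrees_def)

lemma tensor_chain_map_unit_tensor:
  assumes C': "\<And>p. group (chains C' p)" and f: "\<And>p. f p \<in> hom (chains C p) (chains C' p)"
    and g: "\<And>q. g q \<in> hom (chains integer_complex q) (chains integer_complex q)" and g1: "g 0 1 = 1"
    and x: "x \<in> carrier (chains C n)"
  shows "tensor_chain_map C' integer_complex f g n (unit_tensor C n x) = unit_tensor C' n (f n x)"
proof
  fix i :: "nat \<times> nat"
  note Z = concentrated_group [OF group_integer_group]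
  obtain p q where i: "i = (p, q)"
    by (cases i)
  show "tensor_chain_map C' integer_complex f g n (unit_tensor C n x) i = unit_tensor C' n (f n x) i"
  proof (cases "i \<in> bidegrees n")
    case True
    have "tensor_map (chains C' p) (chains integer_complex q) (f p) (g q)
        \<one>\<^bsub>tensor_group (chains C p) (chains integer_complex q)\<^esub> =
        \<one>\<^bsub>tensor_group (chains C' p) (chains integer_complex q)\<^esub>"
      by (intro hom_one [OF tensor_map_hom] tensor_group_group C C' Z f g)
    moreover have "tensor_map (chains C' n) integer_group (f n) (g 0) (pure_tensor (chains C n) integer_group x 1) =
        pure_tensor (chains C' n) integer_group (f n x) 1"
      using tensor_map_pure_tensor [OF C group_integer_group C' group_integer_group f _ x, of "g 0" 1] g [of 0] g1
      by (simp add: chains_concentrated)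
    ultimately show ?thesis
      using True
      by (auto simp: i tensor_chain_map_def unit_tensor_def sum_inj_def bidegrees_def chains_concentrated)
  qed (simp add: i tensor_chain_map_def unit_tensor_def sum_inj_def)
qed

lemma tensor_chain_map_unit_tensor_zero:
  assumes C': "\<And>p. group (chains C' p)" and D': "\<And>q. group (chains D' q)"
    and f: "\<And>p. f p \<in> hom (chains C p) (chains C' p)"
    and g: "\<And>q. g q \<in> hom (chains integer_complex q) (chains D' q)" and g1: "g 0 1 = \<one>\<^bsub>chains D' 0\<^esub>"
    and x: "x \<in> carrier (chains C n)"
  shows "tensor_chain_map C' D' f g n (unit_tensor C n x) = \<one>\<^bsub>chains (tensor_complex C' D') n\<^esub>"
proof
  fix i :: "nat \<times> nat"
  note Z = concentrated_group [OF group_integer_group]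
  obtain p q where i: "i = (p, q)"
    by (cases i)
  show "tensor_chain_map C' D' f g n (unit_tensor C n x) i = \<one>\<^bsub>chains (tensor_complex C' D') n\<^esub> i"
  proof (cases "i \<in> bidegrees n")
    case True
    have "tensor_map (chains C' p) (chains D' q) (f p) (g q)
        \<one>\<^bsub>tensor_group (chains C p) (chains integer_complex q)\<^esub> =
        \<one>\<^bsub>tensor_group (chains C' p) (chains D' q)\<^esub>"
      by (intro hom_one [OF tensor_map_hom] tensor_group_group C C' D' Z f g)
    moreover have "tensor_map (chains C' n) (chains D' 0) (f n) (g 0) (pure_tensor (chains C n) integer_group x 1) =
        \<one>\<^bsub>tensor_group (chains C' n) (chains D' 0)\<^esub>"
    proof -
      have "tensor_map (chains C' n) (chains D' 0) (f n) (g 0) (pure_tensor (chains C n) integer_group x 1) =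
          pure_tensor (chains C' n) (chains D' 0) (f n x) \<one>\<^bsub>chains D' 0\<^esub>"
        using tensor_map_pure_tensor [OF C group_integer_group C' D' [of 0] f _ x, of "g 0" 1] g [of 0] g1
        by (simp add: chains_concentrated)
      also have "\<dots> = \<one>\<^bsub>tensor_group (chains C' n) (chains D' 0)\<^esub>"
        by (intro hom_one [OF pure_tensor_hom_right] tensor_group_group C' D' hom_in_carrier [OF f x])
      finally show ?thesis .
    qed
    ultimately show ?thesis
      using True
      by (auto simp: i tensor_chain_map_def unit_tensor_def sum_inj_def bidegrees_def chains_concentrated
          chains_tensor_complex)
  qed (simp add: i tensor_chain_map_def chains_tensor_complex)
qed

end

text \<open>
  This is needed because the differential of a direct sum of complexes acts on all components, also
  on those where an element vanishes.
\<close>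
lemma bdry_tensor_complex_one:
  assumes C: "\<And>p. group (chains C p)" and D: "\<And>q. group (chains D q)"
    and bC: "\<And>p. bdry C p \<in> hom (chains C (Suc p)) (chains C p)"
    and bD: "\<And>q. bdry D q \<in> hom (chains D (Suc q)) (chains D q)"
  shows "bdry (tensor_complex C D) n \<one>\<^bsub>chains (tensor_complex C D) (Suc n)\<^esub> =
    \<one>\<^bsub>chains (tensor_complex C D) n\<^esub>"
proof
  fix i :: "nat \<times> nat"
  obtain p q where i: "i = (p, q)"
    by (cases i)
  have l: "tensor_map (chains C p) (chains D q) (bdry C p) id \<one>\<^bsub>tensor_group (chains C (Suc p)) (chains D q)\<^esub> =
      \<one>\<^bsub>tensor_group (chains C p) (chains D q)\<^esub>"
    by (intro hom_one [OF tensor_map_hom] tensor_group_group C D bC id_iso iso_imp_homomorphism)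
  have r: "tensor_map (chains C p) (chains D q) id (bdry D q) \<one>\<^bsub>tensor_group (chains C p) (chains D (Suc q))\<^esub> =
      \<one>\<^bsub>tensor_group (chains C p) (chains D q)\<^esub>"
    by (intro hom_one [OF tensor_map_hom] tensor_group_group C D bD id_iso iso_imp_homomorphism)
  interpret group "tensor_group (chains C p) (chains D q)"
    by (simp add: tensor_group_group C D)
  show "bdry (tensor_complex C D) n \<one>\<^bsub>chains (tensor_complex C D) (Suc n)\<^esub> i = \<one>\<^bsub>chains (tensor_complex C D) n\<^esub> i"
    by (auto simp: i tensor_complex_def bidegrees_def l r)
qed

lemma bdry_concentrated_hom:
  "group A \<Longrightarrow> bdry (concentrated A) q \<in> hom (chains (concentrated A) (Suc q)) (chains (concentrated A) q)"
  by (auto simp: concentrated_def hom_def group.is_monoid singleton_group_def)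

text \<open>
  In the Leibniz rule only \<open>\<partial>x \<boxtimes> 1\<close> remains: \<open>1\<close> has degree 0, so \<open>x \<boxtimes> 1\<close> has no component in a
  bidegree \<open>(p, q + 1)\<close>.
\<close>
lemma bdry_unit_tensor:
  assumes C: "\<And>p. group (chains C p)"
    and b: "\<And>p. bdry C p \<in> hom (chains C (Suc p)) (chains C p)"
    and x: "x \<in> carrier (chains C (Suc n))"
  shows "bdry (tensor_complex C integer_complex) n (unit_tensor C (Suc n) x) = unit_tensor C n (bdry C n x)"
proof
  fix i :: "nat \<times> nat"
  note Z = concentrated_group [OF group_integer_group]
  obtain p q where i: "i = (p, q)"
    by (cases i)
  show "bdry (tensor_complex C integer_complex) n (unit_tensor C (Suc n) x) i = unit_tensor C n (bdry C n x) i"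
  proof (cases "i \<in> bidegrees n")
    case True
    then have pq: "(p, q) \<in> bidegrees n" "(Suc p, q) \<in> bidegrees (Suc n)" "(p, Suc q) \<in> bidegrees (Suc n)"
      by (simp_all add: i bidegrees_def)
    let ?T = "tensor_group (chains C p) (chains integer_complex q)"
    interpret T: group ?T
      by (simp add: tensor_group_group C Z)
    have r: "tensor_map (chains C p) (chains integer_complex q) id (bdry integer_complex q)
        (unit_tensor C (Suc n) x (p, Suc q)) = \<one>\<^bsub>?T\<^esub>"
      unfolding unit_tensor_apply [OF C pq(3)]
      by (simp, intro hom_one [OF tensor_map_hom] tensor_group_group C Z
          bdry_concentrated_hom group_integer_group id_iso iso_imp_homomorphism)
    have l: "tensor_map (chains C p) (chains integer_complex q) (bdry C p) id
        (unit_tensor C (Suc n) x (Suc p, q)) = unit_tensor C n (bdry C n x) (p, q)"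
    proof (cases "q = 0")
      case True
      then have "p = n"
        using pq(1) by (simp add: bidegrees_def)
      moreover have "tensor_map (chains C n) integer_group (bdry C n) id (pure_tensor (chains C (Suc n)) integer_group x 1) =
          pure_tensor (chains C n) integer_group (bdry C n x) (id 1)"
        by (intro tensor_map_pure_tensor C b x group_integer_group id_iso iso_imp_homomorphism) simp
      ultimately show ?thesis
        using True unit_tensor_apply [OF C pq(1), of "bdry C n x"] unit_tensor_apply [OF C pq(2), of x]
        by (simp add: chains_concentrated)
    next
      case False
      have "tensor_map (chains C p) (chains integer_complex q) (bdry C p) id
          \<one>\<^bsub>tensor_group (chains C (Suc p)) (chains integer_complex q)\<^esub> = \<one>\<^bsub>?T\<^esub>"
        by (intro hom_one [OF tensor_map_hom] tensor_group_group C Z b id_iso iso_imp_homomorphism)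
      then show ?thesis
        using False by (simp add: unit_tensor_apply [OF C pq(1)] unit_tensor_apply [OF C pq(2)])
    qed
    have "unit_tensor C n (bdry C n x) (p, q) \<in> carrier ?T"
    proof -
      have "unit_tensor C n (bdry C n x) \<in> carrier (chains (tensor_complex C integer_complex) n)"
        by (intro hom_in_carrier [OF unit_tensor_hom] C hom_in_carrier [OF b] x)
      moreover have "(\<lambda>w. w (p, q)) \<in> hom (chains (tensor_complex C integer_complex) n)
          (tensor_summand C integer_complex (p, q))"
        unfolding chains_tensor_complex by (intro sum_component_hom tensor_summand_group C Z pq(1))
      ultimately show ?thesis
        using hom_in_carrier by fastforce
    qed
    then show ?thesis
      using pq l r by (simp add: i tensor_complex_def)
  qed (simp add: i tensor_complex_def unit_tensor_def sum_inj_def)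
qed

section \<open>Coequalisers\<close>

text \<open>
  This is the first isomorphism theorem in each degree. The differential of the coequaliser is well
  defined because a chain map sends its kernel into its kernel, and that it satisfies \<open>\<partial>\<partial> = 0\<close> is then
  inherited from the target.
\<close>
context
  fixes C :: "'c complex_data" and D :: "'a complex_data" and f g :: "nat \<Rightarrow> 'c \<Rightarrow> 'a"
    and M :: "'b complex_data" and \<phi> :: "nat \<Rightarrow> 'a \<Rightarrow> 'b"
  assumes D: "\<And>n. comm_group (chains D n)"
    and bD: "\<And>n. bdry D n \<in> hom (chains D (Suc n)) (chains D n)"
    and M: "chain_complex M" and \<phi>: "chain_map D M \<phi>"
    and surj: "\<And>n. \<phi> n ` carrier (chains D n) = carrier (chains M n)"
    and ker: "\<And>n. kernel (chains D n) (chains M n) (\<phi> n) = coeq_subgroup C D f g n"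
begin

lemma group_hom_to_coequaliser_model: "group_hom (chains D n) (chains M n) (\<phi> n)"
  using D M \<phi> by (simp add: group_hom_def group_hom_axioms_def chain_complex_def chain_map_def comm_group_def)

lemma coeq_subgroup_subgroup: "subgroup (coeq_subgroup C D f g n) (chains D n)"
  using group_hom.subgroup_kernel [OF group_hom_to_coequaliser_model] by (simp flip: ker)

lemma coequaliser_iso_rcoset:
  assumes "x \<in> carrier (chains D n)"
  shows "the_elem (\<phi> n ` (coeq_subgroup C D f g n #>\<^bsub>chains D n\<^esub> x)) = \<phi> n x"
proof -
  interpret group_hom "chains D n" "chains M n" "\<phi> n"
    by (rule group_hom_to_coequaliser_model)
  have "\<phi> n ` (coeq_subgroup C D f g n #>\<^bsub>chains D n\<^esub> x) = {\<phi> n x}"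
    by (rule image_rcoset_eq_singleton [of _ "chains M n"])
       (use assms coeq_subgroup_subgroup homh in \<open>auto simp flip: ker simp: kernel_def\<close>)
  then show ?thesis
    by simp
qed

lemma bdry_coequaliser_rcoset:
  assumes x: "x \<in> carrier (chains D (Suc n))"
  shows "bdry (coequaliser C D f g) n (coeq_subgroup C D f g (Suc n) #>\<^bsub>chains D (Suc n)\<^esub> x) =
    coeq_subgroup C D f g n #>\<^bsub>chains D n\<^esub> bdry D n x"
proof -
  have "bdry D n y \<in> coeq_subgroup C D f g n" if "y \<in> coeq_subgroup C D f g (Suc n)" for y
  proof -
    have y: "y \<in> carrier (chains D (Suc n))" "\<phi> (Suc n) y = \<one>\<^bsub>chains M (Suc n)\<^esub>"
      using that by (auto simp flip: ker simp: kernel_def)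
    have "\<phi> n (bdry D n y) = bdry M n \<one>\<^bsub>chains M (Suc n)\<^esub>"
      using y \<phi> by (simp add: chain_map_def)
    also have "\<dots> = \<one>\<^bsub>chains M n\<^esub>"
      using M by (auto simp: chain_complex_def comm_group_def intro: hom_one)
    finally show ?thesis
      using hom_in_carrier [OF bD y(1)] by (simp flip: ker add: kernel_def)
  qed
  then show ?thesis
    unfolding coequaliser_def
    by (simp, intro quot_map_rcoset bD coeq_subgroup_subgroup x)
       (use D in \<open>auto simp: comm_group_def\<close>)
qed

lemma coequaliser_iso: "chain_iso (coequaliser C D f g) M (\<lambda>n c. the_elem (\<phi> n ` c))"
  unfolding chain_iso_def chain_map_def
proof (intro conjI allI ballI)
  show iso: "(\<lambda>c. the_elem (\<phi> n ` c)) \<in> iso (chains (coequaliser C D f g) n) (chains M n)" for n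
    using group_hom.FactGroup_iso_set [OF group_hom_to_coequaliser_model surj]
    by (simp add: coequaliser_def ker)
  show "(\<lambda>c. the_elem (\<phi> n ` c)) \<in> hom (chains (coequaliser C D f g) n) (chains M n)" for n
    by (rule iso_imp_homomorphism [OF iso])
  show "the_elem (\<phi> n ` bdry (coequaliser C D f g) n c) = bdry M n (the_elem (\<phi> (Suc n) ` c))"
    if "c \<in> carrier (chains (coequaliser C D f g) (Suc n))" for n c
  proof -
    obtain x where x: "x \<in> carrier (chains D (Suc n))"
        and c: "c = coeq_subgroup C D f g (Suc n) #>\<^bsub>chains D (Suc n)\<^esub> x"
      using \<open>c \<in> _\<close> by (auto simp: coequaliser_def carrier_FactGroup)
    show ?thesis
      using \<phi> x hom_in_carrier [OF bD x]
      by (simp add: c bdry_coequaliser_rcoset coequaliser_iso_rcoset chain_map_def)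
  qed
qed

lemma coequaliser_chain_complex: "chain_complex (coequaliser C D f g)"
  unfolding chain_complex_def
proof (intro conjI allI ballI)
  let ?Q = "coequaliser C D f g"
  let ?K = "coeq_subgroup C D f g"
  show Q: "comm_group (chains ?Q n)" for n
    unfolding coequaliser_def by (simp add: comm_group.abelian_FactGroup D coeq_subgroup_subgroup)
  show b: "bdry ?Q n \<in> hom (chains ?Q (Suc n)) (chains ?Q n)" for n
  proof -
    have nrm: "?K n \<lhd> chains D n" for n
      by (simp add: comm_group.subgroup_imp_normal D coeq_subgroup_subgroup)
    have "bdry ?Q n \<in> hom (chains D (Suc n) Mod ?K (Suc n)) (chains D n Mod ?K n)"
      by (rule hom_FactGroupI [OF nrm hom_compose [OF bD normal.r_coset_hom_Mod [OF nrm]]])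
         (simp add: bdry_coequaliser_rcoset)
    then show ?thesis
      by (simp add: coequaliser_def)
  qed
  show "bdry ?Q n (bdry ?Q (Suc n) c) = \<one>\<^bsub>chains ?Q n\<^esub>"
    if c: "c \<in> carrier (chains ?Q (Suc (Suc n)))" for n c
  proof -
    let ?\<eta> = "\<lambda>n c. the_elem (\<phi> n ` c)"
    have \<eta>: "?\<eta> n \<in> iso (chains ?Q n) (chains M n)"
      and comm: "\<And>n c. c \<in> carrier (chains ?Q (Suc n)) \<Longrightarrow> ?\<eta> n (bdry ?Q n c) = bdry M n (?\<eta> (Suc n) c)"
      and hom: "\<And>n. ?\<eta> n \<in> hom (chains ?Q n) (chains M n)" for n
      using coequaliser_iso unfolding chain_iso_def chain_map_def by blast+
    have bc: "bdry ?Q (Suc n) c \<in> carrier (chains ?Q (Suc n))"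
      by (rule hom_in_carrier [OF b c])
    have "?\<eta> n (bdry ?Q n (bdry ?Q (Suc n) c)) = bdry M n (bdry M (Suc n) (?\<eta> (Suc (Suc n)) c))"
      using comm [OF bc] comm [OF c] by simp
    also have "\<dots> = \<one>\<^bsub>chains M n\<^esub>"
      using M hom_in_carrier [OF hom c] by (simp add: chain_complex_def)
    also have "\<dots> = ?\<eta> n \<one>\<^bsub>chains ?Q n\<^esub>"
      using hom_one [OF hom, of n] Q M by (simp add: chain_complex_def comm_group_def)
    finally show ?thesis
      using \<eta> [of n] hom_in_carrier [OF b bc] Q [of n]
      by (meson bij_betw_imp_inj_on comm_group.axioms(2) group.is_monoid inj_onD iso_iff monoid.one_closed iso_def)
  qed
qed

end

section \<open>Natural isomorphisms and homology\<close>

lemma chain_complexD: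
  assumes "chain_complex C"
  shows "comm_group (chains C n)" "group (chains C n)" "bdry C n \<in> hom (chains C (Suc n)) (chains C n)"
    "x \<in> carrier (chains C (Suc (Suc n))) \<Longrightarrow> bdry C n (bdry C (Suc n) x) = \<one>\<^bsub>chains C n\<^esub>"
  using assms by (auto simp: chain_complex_def comm_group_def)

lemma chain_mapD:
  assumes "chain_map C D f"
  shows "f n \<in> hom (chains C n) (chains D n)"
    "x \<in> carrier (chains C (Suc n)) \<Longrightarrow> f n (bdry C n x) = bdry D n (f (Suc n) x)"
  using assms by (auto simp: chain_map_def)

lemma ch_functorD:
  assumes "ch_functor F" "0 \<le> s"
  shows "chain_complex (obj F s)"
    "s \<le> t \<Longrightarrow> chain_map (obj F s) (obj F t) (mor F s t)"
    "x \<in> carrier (chains (obj F s) n) \<Longrightarrow> mor F s s n x = x"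
    "\<lbrakk>s \<le> t; t \<le> u; x \<in> carrier (chains (obj F s) n)\<rbrakk> \<Longrightarrow>
      mor F s u n x = mor F t u n (mor F s t n x)"
  using assms unfolding ch_functor_def by blast+

text \<open>
  Apart from the closure assumption the functor laws for \<open>F\<close> are equations, so they can be tested
  after applying the injective maps \<open>\<eta>\<close>, where they become the laws for \<open>G\<close>.
\<close>
lemma ch_naturally_isomorphic_transfer:
  assumes G: "ch_functor G"
    and F: "\<And>s. 0 \<le> s \<Longrightarrow> chain_complex (obj F s)"
    and \<eta>: "\<And>s. 0 \<le> s \<Longrightarrow> chain_iso (obj F s) (obj G s) (\<eta> s)"
    and closed: "\<And>s t n x. \<lbrakk>0 \<le> s; s \<le> t; x \<in> carrier (chains (obj F s) n)\<rbrakk> \<Longrightarrow>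
      mor F s t n x \<in> carrier (chains (obj F t) n)"
    and nat: "\<And>s t n x. \<lbrakk>0 \<le> s; s \<le> t; x \<in> carrier (chains (obj F s) n)\<rbrakk> \<Longrightarrow>
      \<eta> t n (mor F s t n x) = mor G s t n (\<eta> s n x)"
  shows "ch_naturally_isomorphic F G"
proof -
  have \<eta>_map: "chain_map (obj F s) (obj G s) (\<eta> s)" if "0 \<le> s" for s
    using \<eta> [OF that] by (simp add: chain_iso_def)
  note \<eta>_hom = chain_mapD(1) [OF \<eta>_map]
  note \<eta>_in = hom_in_carrier [OF \<eta>_hom]
  have inj: "x = y" if "0 \<le> s" "\<eta> s n x = \<eta> s n y" "x \<in> carrier (chains (obj F s) n)"
      "y \<in> carrier (chains (obj F s) n)" for s n x y
    using \<eta> [OF that(1)] that by (auto simp: chain_iso_def iso_iff dest: inj_onD)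
  have G_map: "chain_map (obj G s) (obj G t) (mor G s t)" if "0 \<le> s" "s \<le> t" for s t
    by (rule ch_functorD(2) [OF G that])
  have "chain_map (obj F s) (obj F t) (mor F s t)" if st: "0 \<le> s" "s \<le> t" for s t
    unfolding chain_map_def
  proof (intro conjI allI ballI homI)
    have t: "0 \<le> t"
      using st by simp
    fix n
    show "mor F s t n x \<in> carrier (chains (obj F t) n)" if "x \<in> carrier (chains (obj F s) n)" for x
      using closed [OF st that] .
    show "mor F s t n (x \<otimes>\<^bsub>chains (obj F s) n\<^esub> y) = mor F s t n x \<otimes>\<^bsub>chains (obj F t) n\<^esub> mor F s t n y"
      if xy: "x \<in> carrier (chains (obj F s) n)" "y \<in> carrier (chains (obj F s) n)" for x y
    proof (rule inj [OF t])
      have "x \<otimes>\<^bsub>chains (obj F s) n\<^esub> y \<in> carrier (chains (obj F s) n)"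
        using xy chain_complexD(2) [OF F [OF st(1)], of n] by (simp add: group.is_monoid monoid.m_closed)
      moreover from this show "mor F s t n (x \<otimes>\<^bsub>chains (obj F s) n\<^esub> y) \<in> carrier (chains (obj F t) n)"
        by (rule closed [OF st])
      moreover show "mor F s t n x \<otimes>\<^bsub>chains (obj F t) n\<^esub> mor F s t n y \<in> carrier (chains (obj F t) n)"
        using closed [OF st xy(1)] closed [OF st xy(2)] chain_complexD(2) [OF F [OF t], of n]
        by (simp add: group.is_monoid monoid.m_closed)
      ultimately show "\<eta> t n (mor F s t n (x \<otimes>\<^bsub>chains (obj F s) n\<^esub> y)) =
          \<eta> t n (mor F s t n x \<otimes>\<^bsub>chains (obj F t) n\<^esub> mor F s t n y)"
        using xy by (simp add: nat [OF st] closed [OF st] hom_mult [OF \<eta>_hom] st(1) t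
            hom_mult [OF chain_mapD(1) [OF G_map [OF st]]] \<eta>_in)
    qed
    show "mor F s t n (bdry (obj F s) n x) = bdry (obj F t) n (mor F s t (Suc n) x)"
      if x: "x \<in> carrier (chains (obj F s) (Suc n))" for x
    proof (rule inj [OF t])
      have bx: "bdry (obj F s) n x \<in> carrier (chains (obj F s) n)"
        by (rule hom_in_carrier [OF chain_complexD(3) [OF F [OF st(1)]] x])
      show "mor F s t n (bdry (obj F s) n x) \<in> carrier (chains (obj F t) n)"
        by (rule closed [OF st bx])
      show "bdry (obj F t) n (mor F s t (Suc n) x) \<in> carrier (chains (obj F t) n)"
        by (rule hom_in_carrier [OF chain_complexD(3) [OF F [OF t]] closed [OF st x]])
      show "\<eta> t n (mor F s t n (bdry (obj F s) n x)) = \<eta> t n (bdry (obj F t) n (mor F s t (Suc n) x))"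
        using x bx by (simp add: nat [OF st] chain_mapD(2) [OF \<eta>_map] closed [OF st] st(1) t \<eta>_in
            chain_mapD(2) [OF G_map [OF st]])
    qed
  qed
  moreover have "mor F s s n x = x" if "0 \<le> s" "x \<in> carrier (chains (obj F s) n)" for s n x
    using that by (intro inj [OF that(1)]) (simp_all add: nat closed \<eta>_in ch_functorD(3) [OF G])
  moreover have "mor F s u n x = mor F t u n (mor F s t n x)"
    if "0 \<le> s" "s \<le> t" "t \<le> u" "x \<in> carrier (chains (obj F s) n)" for s t u n x
  proof (rule inj [of u])
    have t: "0 \<le> t" and u: "0 \<le> u" "s \<le> u"
      using that by auto
    note c = closed [OF that(1,2,4)]
    show "0 \<le> u" by fact
    show "mor F s u n x \<in> carrier (chains (obj F u) n)"
      by (rule closed [OF that(1) u(2) that(4)])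
    show "mor F t u n (mor F s t n x) \<in> carrier (chains (obj F u) n)"
      by (rule closed [OF t that(3) c])
    have "mor G s u n (\<eta> s n x) = mor G t u n (mor G s t n (\<eta> s n x))"
      by (rule ch_functorD(4) [OF G that(1-3) \<eta>_in [OF that(1,4)]])
    then show "\<eta> u n (mor F s u n x) = \<eta> u n (mor F t u n (mor F s t n x))"
      by (simp add: nat [OF that(1) u(2) that(4)] nat [OF t that(3) c] nat [OF that(1,2,4)])
  qed
  ultimately have "ch_functor F"
    using F unfolding ch_functor_def by blast
  then show ?thesis
    unfolding ch_naturally_isomorphic_def
    by (intro conjI G exI [of _ \<eta>] allI impI ballI) (simp_all add: \<eta> nat)
qed

lemma chain_iso_inv_into:
  assumes C: "chain_complex C" and f: "chain_iso C D f"
  shows "chain_iso D C (\<lambda>n. inv_into (carrier (chains C n)) (f n))"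
  unfolding chain_iso_def chain_map_def
proof (intro conjI allI ballI)
  let ?g = "\<lambda>n. inv_into (carrier (chains C n)) (f n)"
  have f_map: "chain_map C D f" and f_iso: "\<And>n. f n \<in> iso (chains C n) (chains D n)"
    using f by (simp_all add: chain_iso_def)
  have inj: "inj_on (f n) (carrier (chains C n))" and surj: "f n ` carrier (chains C n) = carrier (chains D n)" for n
    using f_iso [of n] by (simp_all add: iso_iff)
  show iso: "?g n \<in> iso (chains D n) (chains C n)" for n
    by (rule group.iso_set_sym [OF chain_complexD(2) [OF C] f_iso])
  show "?g n \<in> hom (chains D n) (chains C n)" for n
    by (rule iso_imp_homomorphism [OF iso])
  show "?g n (bdry D n y) = bdry C n (?g (Suc n) y)" if y': "y \<in> carrier (chains D (Suc n))" for n y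
  proof -
    obtain x where x: "x \<in> carrier (chains C (Suc n))" and y: "y = f (Suc n) x"
      using y' surj [of "Suc n"] by blast
    then show ?thesis
      using hom_in_carrier [OF chain_complexD(3) [OF C] x]
      by (simp add: inv_into_f_f [OF inj] flip: chain_mapD(2) [OF f_map])
  qed
qed

lemma ch_naturally_isomorphic_sym:
  assumes "ch_naturally_isomorphic F G"
  shows "ch_naturally_isomorphic G F"
proof -
  obtain \<eta> where F: "ch_functor F" and G: "ch_functor G"
    and \<eta>: "\<And>s. 0 \<le> s \<Longrightarrow> chain_iso (obj F s) (obj G s) (\<eta> s)"
    and nat: "\<And>s t n x. \<lbrakk>0 \<le> s; s \<le> t; x \<in> carrier (chains (obj F s) n)\<rbrakk> \<Longrightarrow>
      \<eta> t n (mor F s t n x) = mor G s t n (\<eta> s n x)"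
    using assms unfolding ch_naturally_isomorphic_def by blast
  let ?\<theta> = "\<lambda>s n. inv_into (carrier (chains (obj F s) n)) (\<eta> s n)"
  have "chain_iso (obj G s) (obj F s) (?\<theta> s)" if "0 \<le> s" for s
    by (rule chain_iso_inv_into [OF ch_functorD(1) [OF F that] \<eta> [OF that]])
  moreover have "?\<theta> t n (mor G s t n y) = mor F s t n (?\<theta> s n y)"
    if st: "0 \<le> s" "s \<le> t" and y: "y \<in> carrier (chains (obj G s) n)" for s t n y
  proof -
    have inj: "inj_on (\<eta> s n) (carrier (chains (obj F s) n))"
      and surj: "\<eta> s n ` carrier (chains (obj F s) n) = carrier (chains (obj G s) n)" if "0 \<le> s" for s
      using \<eta> [OF that] by (simp_all add: chain_iso_def iso_iff)
    obtain x where x: "x \<in> carrier (chains (obj F s) n)" and yx: "y = \<eta> s n x"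
      using y surj [OF st(1)] by blast
    have "mor F s t n x \<in> carrier (chains (obj F t) n)"
      by (rule hom_in_carrier [OF chain_mapD(1) [OF ch_functorD(2) [OF F st]] x])
    then show ?thesis
      using x st by (simp add: yx inv_into_f_f [OF inj] flip: nat)
  qed
  ultimately show ?thesis
    unfolding ch_naturally_isomorphic_def
    by (intro conjI F G exI [of _ ?\<theta>] allI impI ballI) simp_all
qed

abbreviation cycle_group :: "'a complex_data \<Rightarrow> nat \<Rightarrow> 'a monoid" where
  "cycle_group C n \<equiv> subgroup_generated (chains C n) (cycles C n)"

abbreviation homology_map :: "'b complex_data \<Rightarrow> nat \<Rightarrow> (nat \<Rightarrow> 'a \<Rightarrow> 'b) \<Rightarrow> 'a set \<Rightarrow> 'b set" where
  "homology_map D n f \<equiv> quot_map (chains D n) (boundaries D n) (f n)"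

lemma cycles_subgroup:
  assumes "chain_complex C"
  shows "subgroup (cycles C n) (chains C n)"
proof (cases n)
  case 0
  then show ?thesis
    using chain_complexD(2) [OF assms] by (simp add: group.subgroup_self)
next
  case (Suc m)
  then show ?thesis
    using chain_complexD(2,3) [OF assms]
    by (simp add: group_hom.subgroup_kernel group_hom.intro group_hom_axioms.intro)
qed

lemma carrier_cycle_group: "chain_complex C \<Longrightarrow> carrier (cycle_group C n) = cycles C n"
  by (rule subgroup.carrier_subgroup_generated_subgroup [OF cycles_subgroup])

lemma cycle_group_comm_group: "chain_complex C \<Longrightarrow> comm_group (cycle_group C n)"
  by (simp add: group.abelian_subgroup_generated chain_complexD)

lemma boundaries_subset_cycles: "chain_complex C \<Longrightarrow> boundaries C n \<subseteq> cycles C n"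
  by (cases n) (auto simp: boundaries_def kernel_def chain_complexD intro: hom_in_carrier [OF chain_complexD(3)])

lemma boundaries_subgroup:
  assumes C: "chain_complex C"
  shows "subgroup (boundaries C n) (cycle_group C n)"
proof (rule group.subgroup_of_subgroup_generated [OF chain_complexD(2) [OF C] boundaries_subset_cycles [OF C]])
  show "subgroup (boundaries C n) (chains C n)"
    unfolding boundaries_def
    by (intro group_hom.img_is_subgroup group_hom.intro group_hom_axioms.intro chain_complexD C)
qed

lemma homology_comm_group: "chain_complex C \<Longrightarrow> comm_group (homology n C)"
  unfolding homology_def by (intro comm_group.abelian_FactGroup cycle_group_comm_group boundaries_subgroup)

lemma carrier_homology:
  assumes C: "chain_complex C"
  shows "carrier (homology n C) = (\<lambda>x. boundaries C n #>\<^bsub>chains C n\<^esub> x) ` cycles C n"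
  by (simp add: homology_def carrier_FactGroup carrier_cycle_group C r_coset_def)

context
  fixes C :: "'a complex_data" and D :: "'b complex_data" and f :: "nat \<Rightarrow> 'a \<Rightarrow> 'b"
  assumes C: "chain_complex C" and D: "chain_complex D" and f: "chain_map C D f"
begin

lemma chain_map_cycles: "x \<in> cycles C n \<Longrightarrow> f n x \<in> cycles D n"
proof (cases n)
  case 0
  then show "x \<in> cycles C n \<Longrightarrow> f n x \<in> cycles D n"
    using hom_in_carrier [OF chain_mapD(1) [OF f]] by simp
next
  case (Suc m)
  assume "x \<in> cycles C n"
  then have x: "x \<in> carrier (chains C (Suc m))" "bdry C m x = \<one>\<^bsub>chains C m\<^esub>"
    by (simp_all add: Suc kernel_def)
  have "bdry D m (f (Suc m) x) = f m \<one>\<^bsub>chains C m\<^esub>"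
    using x by (simp flip: chain_mapD(2) [OF f])
  also have "\<dots> = \<one>\<^bsub>chains D m\<^esub>"
    by (rule hom_one [OF chain_mapD(1) [OF f] chain_complexD(2) [OF C] chain_complexD(2) [OF D]])
  finally show ?thesis
    using hom_in_carrier [OF chain_mapD(1) [OF f] x(1)] by (simp add: Suc kernel_def)
qed

lemma chain_map_cycle_group_hom: "f n \<in> hom (cycle_group C n) (cycle_group D n)"
proof (rule homI)
  show "f n x \<in> carrier (cycle_group D n)" if "x \<in> carrier (cycle_group C n)" for x
    using that chain_map_cycles by (simp add: carrier_cycle_group C D)
  show "f n (x \<otimes>\<^bsub>cycle_group C n\<^esub> y) = f n x \<otimes>\<^bsub>cycle_group D n\<^esub> f n y"
    if "x \<in> carrier (cycle_group C n)" "y \<in> carrier (cycle_group C n)" for x y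
    using that subgroup.subset [OF cycles_subgroup [OF C]] hom_mult [OF chain_mapD(1) [OF f]]
    by (simp add: carrier_cycle_group C subset_iff)
qed

lemma homology_map_rcoset:
  assumes x: "x \<in> cycles C n"
  shows "homology_map D n f (boundaries C n #>\<^bsub>chains C n\<^esub> x) = boundaries D n #>\<^bsub>chains D n\<^esub> f n x"
proof -
  have "f n ` boundaries C n \<subseteq> boundaries D n"
    using hom_in_carrier [OF chain_mapD(1) [OF f]]
    by (auto simp: boundaries_def chain_mapD(2) [OF f])
  then have "quot_map (cycle_group D n) (boundaries D n) (f n) (boundaries C n #>\<^bsub>cycle_group C n\<^esub> x) =
      boundaries D n #>\<^bsub>cycle_group D n\<^esub> f n x"
    by (intro quot_map_rcoset chain_map_cycle_group_hom boundaries_subgroup C D)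
       (use x C D in \<open>simp_all add: carrier_cycle_group group.group_subgroup_generated chain_complexD\<close>)
  \<comment> \<open>Cosets in the cycle group and in the chain group are the same sets.\<close>
  then show ?thesis
    by (simp add: quot_map_def set_mult_def r_coset_def)
qed

lemma homology_map_hom: "homology_map D n f \<in> hom (homology n C) (homology n D)"
  unfolding homology_def
proof (rule hom_FactGroupI)
  show nC: "boundaries C n \<lhd> cycle_group C n"
    by (intro comm_group.subgroup_imp_normal cycle_group_comm_group boundaries_subgroup C)
  have nD: "boundaries D n \<lhd> cycle_group D n"
    by (intro comm_group.subgroup_imp_normal cycle_group_comm_group boundaries_subgroup D)
  show "(\<lambda>x. boundaries D n #>\<^bsub>cycle_group D n\<^esub> x) \<circ> f n \<in>
      hom (cycle_group C n) (cycle_group D n Mod boundaries D n)"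
    by (rule hom_compose [OF chain_map_cycle_group_hom normal.r_coset_hom_Mod [OF nD]])
  show "homology_map D n f (boundaries C n #>\<^bsub>cycle_group C n\<^esub> x) =
      ((\<lambda>x. boundaries D n #>\<^bsub>cycle_group D n\<^esub> x) \<circ> f n) x" if "x \<in> carrier (cycle_group C n)" for x
    using that homology_map_rcoset by (simp add: carrier_cycle_group C r_coset_def)
qed

end

lemma homology_map_compose:
  assumes "chain_complex C" "chain_complex D" "chain_complex E" "chain_map C D f" "chain_map D E g" "chain_map C E h"
    and h: "\<And>x. x \<in> carrier (chains C n) \<Longrightarrow> h n x = g n (f n x)" and c: "c \<in> carrier (homology n C)"
  shows "homology_map E n h c = homology_map E n g (homology_map D n f c)"
proof -
  obtain x where x: "x \<in> cycles C n" and c: "c = boundaries C n #>\<^bsub>chains C n\<^esub> x"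
    using c assms(1) by (auto simp: carrier_homology)
  then show ?thesis
    using assms h [of x] subgroup.subset [OF cycles_subgroup [OF assms(1)], of n]
    by (auto simp: homology_map_rcoset [of C D] homology_map_rcoset [of D E] homology_map_rcoset [of C E]
        chain_map_cycles [of C D])
qed

lemma homology_map_ident:
  assumes "chain_complex C" "chain_map C C h"
    and h: "\<And>x. x \<in> carrier (chains C n) \<Longrightarrow> h n x = x" and c: "c \<in> carrier (homology n C)"
  shows "homology_map C n h c = c"
proof -
  obtain x where x: "x \<in> cycles C n" and c: "c = boundaries C n #>\<^bsub>chains C n\<^esub> x"
    using c assms(1) by (auto simp: carrier_homology)
  then show ?thesis
    using assms h [of x] subgroup.subset [OF cycles_subgroup [OF assms(1)], of n]
    by (auto simp: homology_map_rcoset [of C C])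
qed

lemma homology_map_iso:
  assumes C: "chain_complex C" and D: "chain_complex D" and f: "chain_iso C D f"
  shows "homology_map D n f \<in> iso (homology n C) (homology n D)"
proof -
  let ?g = "\<lambda>n. inv_into (carrier (chains C n)) (f n)"
  have fm: "chain_map C D f" and gm: "chain_map D C ?g"
    using f chain_iso_inv_into [OF C f] by (simp_all add: chain_iso_def)
  have bij: "bij_betw (f n) (carrier (chains C n)) (carrier (chains D n))" for n
    using f by (simp add: chain_iso_def iso_def)
  have idm: "chain_map E E (\<lambda>n x. x)" for E :: "'e complex_data"
    by (auto simp: chain_map_def hom_def)
  have "group_isomorphisms (homology n C) (homology n D) (homology_map D n f) (homology_map C n ?g)"
    unfolding group_isomorphisms_def
  proof (intro conjI ballI)
    show "homology_map D n f \<in> hom (homology n C) (homology n D)"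
      by (rule homology_map_hom [OF C D fm])
    show "homology_map C n ?g \<in> hom (homology n D) (homology n C)"
      by (rule homology_map_hom [OF D C gm])
    show "homology_map C n ?g (homology_map D n f c) = c" if "c \<in> carrier (homology n C)" for c
      using homology_map_compose [OF C D C fm gm idm _ that] homology_map_ident [OF C idm _ that]
        bij_betw_inv_into_left [OF bij] by simp
    show "homology_map D n f (homology_map C n ?g c) = c" if "c \<in> carrier (homology n D)" for c
      using homology_map_compose [OF D C D gm fm idm _ that] homology_map_ident [OF D idm _ that]
        bij_betw_inv_into_right [OF bij] by simp
  qed
  then show ?thesis
    by (rule group_isomorphisms_imp_iso)
qed

lemma ab_functor_homology:
  assumes F: "ch_functor F"
  shows "ab_functor (homology_functor n F)"
proof -
  have cc: "chain_complex (obj F s)" if "0 \<le> s" for s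
    by (rule ch_functorD(1) [OF F that])
  have cm: "chain_map (obj F s) (obj F t) (mor F s t)" if "0 \<le> s" "s \<le> t" for s t
    by (rule ch_functorD(2) [OF F that])
  show ?thesis
    unfolding ab_functor_def homology_functor_def diagram.simps
  proof (intro conjI allI impI ballI)
    fix s :: real
    assume s: "0 \<le> s"
    show "comm_group (homology n (obj F s))"
      by (rule homology_comm_group [OF cc [OF s]])
    show "homology_map (obj F s) n (mor F s s) c = c" if c: "c \<in> carrier (homology n (obj F s))" for c
      by (rule homology_map_ident [OF cc [OF s] cm [OF s order.refl] ch_functorD(3) [OF F s] c])
    fix t
    assume t: "s \<le> t"
    then have t0: "0 \<le> t"
      using s by simp
    show "homology_map (obj F t) n (mor F s t) \<in> hom (homology n (obj F s)) (homology n (obj F t))"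
      by (rule homology_map_hom [OF cc [OF s] cc [OF t0] cm [OF s t]])
    fix u c
    assume u: "t \<le> u" and c: "c \<in> carrier (homology n (obj F s))"
    then have su: "s \<le> u" and u0: "0 \<le> u"
      using t t0 by auto
    have "mor F s u n x = mor F t u n (mor F s t n x)" if "x \<in> carrier (chains (obj F s) n)" for x
      by (rule ch_functorD(4) [OF F s t u that])
    then show "homology_map (obj F u) n (mor F s u) c =
        homology_map (obj F u) n (mor F t u) (homology_map (obj F t) n (mor F s t) c)"
      by (rule homology_map_compose [OF cc [OF s] cc [OF t0] cc [OF u0] cm [OF s t] cm [OF t0 u] cm [OF s su] _ c])
  qed
qed

lemma ab_naturally_isomorphic_homology:
  assumes "ch_naturally_isomorphic F G"
  shows "ab_naturally_isomorphic (homology_functor n F) (homology_functor n G)"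
proof -
  obtain \<eta> where F: "ch_functor F" and G: "ch_functor G"
    and \<eta>: "\<And>s. 0 \<le> s \<Longrightarrow> chain_iso (obj F s) (obj G s) (\<eta> s)"
    and nat: "\<And>s t n x. \<lbrakk>0 \<le> s; s \<le> t; x \<in> carrier (chains (obj F s) n)\<rbrakk> \<Longrightarrow>
      \<eta> t n (mor F s t n x) = mor G s t n (\<eta> s n x)"
    using assms unfolding ch_naturally_isomorphic_def by blast
  have ccF: "chain_complex (obj F s)" and ccG: "chain_complex (obj G s)"
    and \<eta>m: "chain_map (obj F s) (obj G s) (\<eta> s)" if "0 \<le> s" for s
    using \<eta> [OF that] by (simp_all add: ch_functorD(1) [OF F that] ch_functorD(1) [OF G that] chain_iso_def)
  have cmF: "chain_map (obj F s) (obj F t) (mor F s t)"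
    and cmG: "chain_map (obj G s) (obj G t) (mor G s t)" if "0 \<le> s" "s \<le> t" for s t
    by (rule ch_functorD(2) [OF F that], rule ch_functorD(2) [OF G that])
  let ?H = "\<lambda>s. homology_map (obj G s) n (\<eta> s)"
  have "?H s \<in> iso (homology n (obj F s)) (homology n (obj G s))" if "0 \<le> s" for s
    by (rule homology_map_iso [OF ccF [OF that] ccG [OF that] \<eta> [OF that]])
  moreover have "?H t (homology_map (obj F t) n (mor F s t) c) = homology_map (obj G t) n (mor G s t) (?H s c)"
    if st: "0 \<le> s" "s \<le> t" and c: "c \<in> carrier (homology n (obj F s))" for s t c
  proof -
    have t: "0 \<le> t"
      using st by simp
    let ?h = "\<lambda>n x. mor G s t n (\<eta> s n x)"
    have hm: "chain_map (obj F s) (obj G t) ?h"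
      unfolding chain_map_def
    proof (intro conjI allI ballI)
      show "?h m \<in> hom (chains (obj F s) m) (chains (obj G t) m)" for m
        using hom_compose [OF chain_mapD(1) [OF \<eta>m [OF st(1)]] chain_mapD(1) [OF cmG [OF st]], of m]
        by (simp add: comp_def)
      show "?h m (bdry (obj F s) m x) = bdry (obj G t) m (?h (Suc m) x)"
        if "x \<in> carrier (chains (obj F s) (Suc m))" for m x
        using that hom_in_carrier [OF chain_mapD(1) [OF \<eta>m [OF st(1)]]]
        by (simp add: chain_mapD(2) [OF \<eta>m [OF st(1)]] chain_mapD(2) [OF cmG [OF st]])
    qed
    have "homology_map (obj G t) n ?h c = ?H t (homology_map (obj F t) n (mor F s t) c)"
      by (rule homology_map_compose [OF ccF [OF st(1)] ccF [OF t] ccG [OF t] cmF [OF st] \<eta>m [OF t] hm _ c])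
         (simp add: nat [OF st])
    moreover have "homology_map (obj G t) n ?h c = homology_map (obj G t) n (mor G s t) (?H s c)"
      by (rule homology_map_compose [OF ccF [OF st(1)] ccG [OF st(1)] ccG [OF t] \<eta>m [OF st(1)] cmG [OF st] hm _ c])
         simp
    ultimately show ?thesis
      by simp
  qed
  ultimately show ?thesis
    using ab_functor_homology [OF F] ab_functor_homology [OF G]
    unfolding ab_naturally_isomorphic_def homology_functor_def diagram.simps
    by (intro conjI exI [of _ ?H] allI impI ballI) simp_all
qed

section \<open>Faces of tuples and their lengths\<close>

lemma tuple_length_single [simp]: "tuple_length d [a] = 0"
  by (simp add: tuple_length_def)

lemma tuple_length_Cons_Cons [simp]: "tuple_length d (a # b # xs) = d a b + tuple_length d (b # xs)"
  by (simp add: tuple_length_def sum.lessThan_Suc_shift del: sum.lessThan_Suc)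

lemma tuple_length_append:
  "tuple_length d (us @ a # vs) = tuple_length d (us @ [a]) + tuple_length d (a # vs)"
proof (induction us)
  case (Cons u us)
  then show ?case
    by (cases us) simp_all
qed simp

text \<open>The amount by which the \<open>i\<close>-th face of a tuple \<open>(x\<^sub>0, \<dots>, x\<^sub>n)\<close> is shorter than the tuple.\<close>
definition face_defect :: "('x \<Rightarrow> 'x \<Rightarrow> real) \<Rightarrow> nat \<Rightarrow> nat \<Rightarrow> 'x list \<Rightarrow> real" where
  "face_defect d n i xs =
     (if i = 0 then d (xs ! 0) (xs ! 1)
      else if i = n then d (xs ! (n - 1)) (xs ! n)
      else d (xs ! (i - 1)) (xs ! i) + d (xs ! i) (xs ! (i + 1)) - d (xs ! (i - 1)) (xs ! (i + 1)))"

lemma magnitude_face_eq: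
  "magnitude_face d n i xs = (if face_defect d n i xs = 0 then frag_of (delete_entry i xs) else 0)"
  by (simp add: magnitude_face_def face_defect_def)

text \<open>
  The tuple is split around the deleted entry; the parts before and after it contribute equally to
  both lengths, so the difference only involves the deleted entry and its neighbours.
\<close>
lemma tuple_length_delete_entry:
  assumes len: "length xs = Suc (Suc n)" and i: "i \<le> Suc n"
  shows "tuple_length d xs = tuple_length d (delete_entry i xs) + face_defect d (Suc n) i xs"
proof -
  consider "i = 0" | "i = Suc n" | k where "i = Suc k" "k < n"
    using i by (cases i) force+
  then show ?thesis
  proof cases
    case 1
    obtain a b zs where "xs = a # b # zs"
      using len by (metis length_Suc_conv)
    then show ?thesis
      by (simp add: 1 delete_entry_def face_defect_def)
  next
    case 2
    obtain ys b where ys: "xs = ys @ [b]" "length ys = Suc n"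
      using len by (cases xs rule: rev_cases) auto
    obtain us a where us: "ys = us @ [a]" "length us = n"
      using ys(2) by (cases ys rule: rev_cases) auto
    show ?thesis
      using tuple_length_append [of d us a "[b]"] us ys
      by (simp add: 2 delete_entry_def face_defect_def nth_append)
  next
    case 3
    define us where "us = take k xs"
    obtain a b c vs where drop: "drop k xs = a # b # c # vs"
    proof -
      have "length (drop k xs) = Suc (Suc (Suc (n - Suc k)))"
        using len 3 by simp
      then show thesis
        using that by (metis length_Suc_conv)
    qed
    have xs: "xs = us @ a # b # c # vs" and us: "length us = k"
      using len 3 by (simp_all add: us_def flip: drop)
    have nth: "xs ! k = a" "xs ! Suc k = b" "xs ! Suc (Suc k) = c"
      by (simp_all add: xs us [symmetric] nth_append)
    have "delete_entry i xs = us @ a # c # vs"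
      by (simp add: xs delete_entry_def 3 us [symmetric])
    then show ?thesis
      using tuple_length_append [of d us a "b # c # vs"] tuple_length_append [of d us a "c # vs"] 3
      by (simp add: face_defect_def nth) (simp add: xs)
  qed
qed

lemma delete_entry_tuples: "xs \<in> tuples X (Suc n) \<Longrightarrow> i \<le> Suc n \<Longrightarrow> delete_entry i xs \<in> tuples X n"
  using set_take_subset [of i xs] set_drop_subset [of "Suc i" xs]
  by (auto simp: tuples_def delete_entry_def)

lemma (in quasi_pseudometric_space) face_defect_nonneg:
  assumes xs: "xs \<in> tuples X (Suc n)" and i: "i \<le> Suc n"
  shows "0 \<le> face_defect d (Suc n) i xs"
proof -
  have "xs ! j \<in> X" if "j \<le> Suc n" for j
    using xs that by (auto simp: tuples_def subset_iff)
  then show ?thesis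
    using i nonneg triangle by (auto simp: face_defect_def)
qed

lemma delete_entry_delete_entry:
  "j \<le> i \<Longrightarrow> delete_entry j (delete_entry (Suc i) xs) = delete_entry i (delete_entry j xs)"
proof (induction j arbitrary: i xs)
  case 0
  then show ?case
    by (cases xs) (simp_all add: delete_entry_def)
next
  case (Suc j)
  then obtain i' where i: "i = Suc i'" "j \<le> i'"
    by (cases i) auto
  then show ?case
    using Suc.IH [OF i(2)] by (cases xs) (simp_all add: delete_entry_def)
qed

section \<open>The chains of the nerve and the magnitude chains\<close>

lemma frag_cmul_frag_extend: "frag_cmul k (frag_extend b c) = frag_extend (\<lambda>x. frag_cmul k (b x)) c"
  by (simp add: frag_extend_def frag_cmul_sum mult.commute)

lemma sum_frag_extend: "(\<Sum>i\<in>I. frag_extend (b i) c) = frag_extend (\<lambda>x. \<Sum>i\<in>I. b i x) c"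
  unfolding frag_extend_def by (simp add: frag_cmul_sum sum.swap [of _ I])

lemma finprod_free_Abelian_group:
  assumes "finite I" "\<And>i. i \<in> I \<Longrightarrow> Poly_Mapping.keys (f i) \<subseteq> S"
  shows "finprod (free_Abelian_group S) f I = sum f I"
  using assms
proof (induction I rule: finite_induct)
  case empty
  interpret comm_group "free_Abelian_group S"
    by (rule abelian_free_Abelian_group)
  show ?case
    by simp
next
  case (insert i I)
  interpret comm_group "free_Abelian_group S"
    by (rule abelian_free_Abelian_group)
  show ?case
    using insert by (subst finprod_insert) (auto simp: Pi_iff)
qed

definition nerve_bdry :: "nat \<Rightarrow> ('x list \<Rightarrow>\<^sub>0 int) \<Rightarrow> ('x list \<Rightarrow>\<^sub>0 int)" where
  "nerve_bdry n = frag_extend (\<lambda>xs. \<Sum>i\<le>Suc n. frag_cmul ((-1) ^ i) (frag_of (delete_entry i xs)))"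

text \<open>
  The terms of the double sum cancel in pairs: deleting entry \<open>i\<close> and then \<open>j < i\<close> agrees with
  deleting \<open>j\<close> and then \<open>i - 1\<close>, with opposite signs.
\<close>
lemma nerve_bdry_nerve_bdry: "nerve_bdry n (nerve_bdry (Suc n) c) = 0"
proof -
  have zero: "nerve_bdry n (nerve_bdry (Suc n) (frag_of xs)) = 0" for xs :: "'x list"
  proof -
    define t where "t = (\<lambda>(i, j). frag_cmul ((-1) ^ (i + j)) (frag_of (delete_entry j (delete_entry i xs))))"
    let ?A = "{(i, j). i \<le> Suc (Suc n) \<and> j < i}" and ?B = "{(i, j). i \<le> j \<and> j \<le> Suc n}"
    have fin: "finite ?A" "finite ?B"
      by (auto intro: finite_subset [of _ "{..Suc (Suc n)} \<times> {..Suc (Suc n)}"])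
    have "nerve_bdry n (nerve_bdry (Suc n) (frag_of xs)) = (\<Sum>i\<le>Suc (Suc n). \<Sum>j\<le>Suc n. t (i, j))"
      unfolding nerve_bdry_def
      by (simp add: frag_extend_sum frag_extend_cmul frag_cmul_sum t_def power_add comp_def
          frag_cmul_distrib2 frag_extend_add)
    also have "\<dots> = sum t ({..Suc (Suc n)} \<times> {..Suc n})"
      by (simp only: sum.cartesian_product case_prod_eta)
    also have "{..Suc (Suc n)} \<times> {..Suc n} = ?A \<union> ?B"
      by auto
    also have "sum t (?A \<union> ?B) = sum t ?A + sum t ?B"
      by (rule sum.union_disjoint [OF fin]) auto
    also have "sum t ?A = (\<Sum>p\<in>?B. - t p)"
    proof (rule sum.reindex_bij_witness [of _ "\<lambda>(i, j). (Suc j, i)" "\<lambda>(i, j). (j, i - 1)"])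
      fix p
      assume "p \<in> ?A"
      then obtain i j where "p = (Suc i, j)" "j \<le> i" "i \<le> Suc n"
        by (cases p; cases "fst p") auto
      then show "(\<lambda>(i, j). (Suc j, i)) ((\<lambda>(i, j). (j, i - 1)) p) = p" "(\<lambda>(i, j). (j, i - 1)) p \<in> ?B"
        "- t ((\<lambda>(i, j). (j, i - 1)) p) = t p"
        by (simp_all add: t_def delete_entry_delete_entry add.commute)
    qed auto
    finally show ?thesis
      by (simp add: sum_negf)
  qed
  show ?thesis
    using subset_UNIV
  proof (induction c rule: frag_induction)
    case (diff a b)
    then show ?case
      by (simp add: nerve_bdry_def frag_extend_diff)
  qed (use zero in \<open>simp_all add: nerve_bdry_def\<close>)
qed

lemma chains_CN:
  "chains (obj (CN X d) s) n = free_Abelian_group {xs \<in> tuples X n. tuple_length d xs \<le> s}"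
  by (simp add: CN_def nerve_def free_simplicial_def unnormalised_def)

lemma chains_CN_group: "group (chains (obj (CN X d) s) p)"
  by (simp add: chains_CN)

lemma mor_CN: "mor (CN X d) s t n = id"
  by (simp add: CN_def nerve_def free_map_def fun_eq_iff flip: frag_expansion)

lemma chains_magnitude:
  "chains (obj (magnitude X d) s) n = free_Abelian_group {xs \<in> tuples X n. tuple_length d xs = s}"
  by (simp add: magnitude_def)

definition exact_length_part :: "('x \<Rightarrow> 'x \<Rightarrow> real) \<Rightarrow> real \<Rightarrow> ('x list \<Rightarrow>\<^sub>0 int) \<Rightarrow> ('x list \<Rightarrow>\<^sub>0 int)" where
  "exact_length_part d e = frag_extend (\<lambda>xs. if tuple_length d xs = e then frag_of xs else 0)"

lemma exact_length_part_hom: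
  "exact_length_part d e \<in> hom (chains (obj (CN X d) e) n) (chains (obj (magnitude X d) e) n)"
  unfolding exact_length_part_def chains_CN chains_magnitude by (rule frag_extend_hom) auto

lemma exact_length_part_ident:
  assumes "x \<in> carrier (chains (obj (magnitude X d) e) n)"
  shows "exact_length_part d e x = x"
proof -
  have "exact_length_part d e x = frag_extend frag_of x"
    unfolding exact_length_part_def using assms by (intro frag_extend_eq) (auto simp: chains_magnitude)
  then show ?thesis
    by (simp flip: frag_expansion)
qed

lemma lookup_exact_length_part:
  "Poly_Mapping.lookup (exact_length_part d e c) xs =
    (if tuple_length d xs = e then Poly_Mapping.lookup c xs else 0)"
  using subset_UNIV
proof (induction c rule: frag_induction)
  case (diff a b)
  then show ?case
    by (simp add: exact_length_part_def frag_extend_diff lookup_minus)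
qed (auto simp: exact_length_part_def)

text \<open>
  Degreewise, but not compatibly with the differentials, the magnitude chains are a subgroup of the
  chains of the nerve.
\<close>
lemma magnitude_in_CN:
  "x \<in> carrier (chains (obj (magnitude X d) e) n) \<Longrightarrow> x \<in> carrier (chains (obj (CN X d) e) n)"
  by (auto simp: chains_magnitude chains_CN)

context quasi_pseudometric_space
begin

lemma CN_face:
  "xs \<in> tuples X (Suc n) \<Longrightarrow> tuple_length d xs \<le> s \<Longrightarrow> i \<le> Suc n \<Longrightarrow>
    delete_entry i xs \<in> tuples X n \<and> tuple_length d (delete_entry i xs) \<le> s"
  using face_defect_nonneg [of xs n i] tuple_length_delete_entry [of xs n i d]
  by (auto simp: delete_entry_tuples) (simp add: tuples_def)

lemma bdry_CN:
  assumes x: "x \<in> carrier (chains (obj (CN X d) s) (Suc n))"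
  shows "bdry (obj (CN X d) s) n x = nerve_bdry n x"
proof -
  let ?S = "{xs \<in> tuples X n. tuple_length d xs \<le> s}"
  have face: "free_map (delete_entry i) x \<in> carrier (free_Abelian_group ?S)" if "i \<le> Suc n" for i
    unfolding free_map_def
    by (rule hom_in_carrier [OF frag_extend_hom x [unfolded chains_CN]]) (use CN_face that in auto)
  have pow: "free_map (delete_entry i) x [^]\<^bsub>free_Abelian_group ?S\<^esub> ((-1) ^ i :: int) =
      frag_cmul ((-1) ^ i) (free_map (delete_entry i) x)" if "i \<le> Suc n" for i
    using face [OF that] by simp
  have "bdry (obj (CN X d) s) n x = finprod (free_Abelian_group ?S)
      (\<lambda>i. free_map (delete_entry i) x [^]\<^bsub>free_Abelian_group ?S\<^esub> ((-1) ^ i :: int)) {..Suc n}"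
    by (simp add: CN_def nerve_def free_simplicial_def unnormalised_def)
  also have "\<dots> = (\<Sum>i\<le>Suc n. free_map (delete_entry i) x [^]\<^bsub>free_Abelian_group ?S\<^esub> ((-1) ^ i :: int))"
    by (rule finprod_free_Abelian_group) (use face pow in \<open>auto intro: order.trans [OF keys_cmul]\<close>)
  also have "\<dots> = (\<Sum>i\<le>Suc n. frag_cmul ((-1) ^ i) (free_map (delete_entry i) x))"
    by (intro sum.cong pow) simp_all
  also have "\<dots> = nerve_bdry n x"
    by (simp only: free_map_def frag_cmul_frag_extend sum_frag_extend nerve_bdry_def)
  finally show ?thesis .
qed

lemma bdry_CN_hom: "bdry (obj (CN X d) s) n \<in> hom (chains (obj (CN X d) s) (Suc n)) (chains (obj (CN X d) s) n)"
proof -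
  have "nerve_bdry n \<in> hom (chains (obj (CN X d) s) (Suc n)) (chains (obj (CN X d) s) n)"
    unfolding nerve_bdry_def chains_CN
    by (rule frag_extend_hom) (use CN_face in \<open>fastforce intro!: order.trans [OF keys_sum] split: if_splits\<close>)
  then show ?thesis
    using bdry_CN [of _ s n] chains_CN_group [of X d s "Suc n"]
    by (auto simp: hom_def Pi_iff group.is_monoid monoid.m_closed)
qed

text \<open>
  On a tuple of length exactly \<open>e\<close> the faces that keep the length are the faces of the magnitude
  complex, and a tuple of smaller length has no face of length \<open>e\<close>.
\<close>
lemma exact_length_part_bdry:
  assumes x: "x \<in> carrier (chains (obj (CN X d) e) (Suc n))"
  shows "exact_length_part d e (bdry (obj (CN X d) e) n x) =
    bdry (obj (magnitude X d) e) n (exact_length_part d e x)"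
proof -
  have x': "Poly_Mapping.keys x \<subseteq> {xs \<in> tuples X (Suc n). tuple_length d xs \<le> e}"
    using x by (simp add: chains_CN)
  have face: "exact_length_part d e (frag_of (delete_entry i xs)) =
      (if tuple_length d xs = e then magnitude_face d (Suc n) i xs else 0)"
    if "xs \<in> tuples X (Suc n)" "tuple_length d xs \<le> e" "i \<le> Suc n" for i xs
  proof -
    have "tuple_length d xs = tuple_length d (delete_entry i xs) + face_defect d (Suc n) i xs"
      using that by (intro tuple_length_delete_entry) (simp_all add: tuples_def)
    then show ?thesis
      using face_defect_nonneg [OF that(1,3)] that(2)
      by (auto simp: exact_length_part_def magnitude_face_eq)
  qed
  have "exact_length_part d e (nerve_bdry n x) =
    bdry (obj (magnitude X d) e) n (exact_length_part d e x)"
    using x'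
  proof (induction x rule: frag_induction)
    case zero
    then show ?case
      by (simp add: exact_length_part_def nerve_bdry_def magnitude_def)
  next
    case (one xs)
    have "exact_length_part d e (nerve_bdry n (frag_of xs)) =
        (\<Sum>i\<le>Suc n. frag_cmul ((-1) ^ i) (exact_length_part d e (frag_of (delete_entry i xs))))"
      unfolding nerve_bdry_def frag_extend_of exact_length_part_def
      by (simp only: frag_extend_sum [OF finite_atMost] comp_def frag_extend_cmul frag_extend_of)
    also have "\<dots> = (\<Sum>i\<le>Suc n. frag_cmul ((-1) ^ i)
        (if tuple_length d xs = e then magnitude_face d (Suc n) i xs else 0))"
      using one by (intro sum.cong) (simp_all add: face)
    also have "\<dots> = bdry (obj (magnitude X d) e) n (exact_length_part d e (frag_of xs))"
      by (simp add: exact_length_part_def magnitude_def)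
    finally show ?case .
  next
    case (diff a b)
    then show ?case
      by (simp add: exact_length_part_def nerve_bdry_def magnitude_def frag_extend_diff)
  qed
  then show ?thesis
    by (simp add: bdry_CN [OF x])
qed

text \<open>
  Every chain of the magnitude complex is the exact-length part of itself, so the magnitude complex
  inherits \<open>\<partial>\<partial> = 0\<close> from the chains of the nerve.
\<close>
lemma magnitude_chain_complex: "chain_complex (obj (magnitude X d) e)"
  unfolding chain_complex_def
proof (intro conjI allI ballI homI)
  let ?C = "obj (CN X d) e" and ?M = "obj (magnitude X d) e" and ?\<pi> = "exact_length_part d e"
  have bdry: "bdry ?M n x = ?\<pi> (bdry ?C n x)" if "x \<in> carrier (chains ?M (Suc n))" for n x
    using that by (simp add: exact_length_part_bdry magnitude_in_CN exact_length_part_ident)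
  show "comm_group (chains ?M n)" for n
    by (simp add: chains_magnitude abelian_free_Abelian_group)
  show closed: "bdry ?M n x \<in> carrier (chains ?M n)" if "x \<in> carrier (chains ?M (Suc n))" for n x
    unfolding bdry [OF that]
    by (intro hom_in_carrier [OF exact_length_part_hom] hom_in_carrier [OF bdry_CN_hom] magnitude_in_CN that)
  show "bdry ?M n (x \<otimes>\<^bsub>chains ?M (Suc n)\<^esub> y) = bdry ?M n x \<otimes>\<^bsub>chains ?M n\<^esub> bdry ?M n y"
    if "x \<in> carrier (chains ?M (Suc n))" "y \<in> carrier (chains ?M (Suc n))" for n x y
    by (simp add: magnitude_def frag_extend_add)
  show "bdry ?M n (bdry ?M (Suc n) x) = \<one>\<^bsub>chains ?M n\<^esub>"
    if x: "x \<in> carrier (chains ?M (Suc (Suc n)))" for n x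
  proof -
    have xC: "x \<in> carrier (chains ?C (Suc (Suc n)))"
      by (rule magnitude_in_CN [OF x])
    have bxC: "bdry ?C (Suc n) x \<in> carrier (chains ?C (Suc n))"
      by (rule hom_in_carrier [OF bdry_CN_hom xC])
    have "bdry ?M n (bdry ?M (Suc n) x) = ?\<pi> (bdry ?C n (bdry ?C (Suc n) x))"
      by (simp add: bdry [OF x] exact_length_part_bdry [OF bxC])
    also have "\<dots> = ?\<pi> (nerve_bdry n (nerve_bdry (Suc n) x))"
      by (subst bdry_CN [OF bxC]) (simp add: bdry_CN [OF xC])
    also have "\<dots> = \<one>\<^bsub>chains ?M n\<^esub>"
      by (simp add: nerve_bdry_nerve_bdry exact_length_part_def chains_magnitude)
    finally show ?thesis .
  qed
qed

lemma magnitude_ch_functor: "ch_functor (magnitude X d)"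
proof -
  have "chain_map (obj (magnitude X d) s) (obj (magnitude X d) t) (mor (magnitude X d) s t)" for s t
    by (auto simp: chain_map_def magnitude_def hom_def)
  then show ?thesis
    using magnitude_chain_complex by (auto simp: ch_functor_def magnitude_def)
qed

end

section \<open>Coends\<close>

abbreviation coend_source_index :: "(real \<times> real) set" where
  "coend_source_index \<equiv> {(s, t). 0 \<le> s \<and> s \<le> t}"

abbreviation coend_source_summand ::
    "'a ch_diagram \<Rightarrow> 'b ch_diagram \<Rightarrow> nat \<Rightarrow> real \<times> real \<Rightarrow> (nat \<times> nat \<Rightarrow> ('a \<times> 'b \<Rightarrow>\<^sub>0 int) set) monoid" where
  "coend_source_summand F A n \<equiv> \<lambda>(s, t). chains (tensor_complex (obj F s) (obj A t)) n"

abbreviation coend_target_summand ::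
    "'a ch_diagram \<Rightarrow> 'b ch_diagram \<Rightarrow> nat \<Rightarrow> real \<Rightarrow> (nat \<times> nat \<Rightarrow> ('a \<times> 'b \<Rightarrow>\<^sub>0 int) set) monoid" where
  "coend_target_summand F A n \<equiv> \<lambda>s. chains (tensor_complex (obj F s) (obj A s)) n"

lemma chains_coend_source:
  "chains (coend_source F A) n = sum_group coend_source_index (coend_source_summand F A n)"
  by (simp add: coend_source_def sum_complex_def case_prod_unfold)

lemma chains_coend_target: "chains (coend_target F A) n = sum_group {0..} (coend_target_summand F A n)"
  by (simp add: coend_target_def sum_complex_def)

context
  fixes F :: "'a ch_diagram" and A :: "'b ch_diagram"
  assumes F: "\<And>s p. group (chains (obj F s) p)" and A: "\<And>s q. group (chains (obj A s) q)"
begin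

lemma coend_source_summand_group: "group (coend_source_summand F A n i)"
  by (cases i) (simp add: tensor_complex_group F A)

lemma coend_target_summand_comm_group: "comm_group (coend_target_summand F A n s)"
  by (rule tensor_complex_comm_group [OF F A])

lemma coend_target_summand_group: "group (coend_target_summand F A n s)"
  by (rule tensor_complex_group [OF F A])

lemma coend_source_group: "group (chains (coend_source F A) n)"
  unfolding chains_coend_source by (rule sum_group [OF coend_source_summand_group])

lemma coend_target_comm_group: "comm_group (chains (coend_target F A) n)"
  unfolding chains_coend_target by (rule comm_group_sum_group [OF coend_target_summand_comm_group])

lemma coend_target_component:
  "z \<in> carrier (chains (coend_target F A) n) \<Longrightarrow> 0 \<le> s \<Longrightarrow> z s \<in> carrier (coend_target_summand F A n s)"
  unfolding chains_coend_target
  by (rule hom_in_carrier [OF sum_component_hom [OF coend_target_summand_group]]) simp_all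

lemma coend_inj_hom: "0 \<le> t \<Longrightarrow> coend_inj F A t n \<in> hom (coend_target_summand F A n t) (chains (coend_target F A) n)"
  unfolding coend_inj_def chains_coend_target by (intro sum_inj_hom coend_target_summand_group) simp

end

context
  fixes F :: "'a ch_diagram" and A :: "'b ch_diagram"
  assumes F: "\<And>s p. group (chains (obj F s) p)" and A: "\<And>s q. group (chains (obj A s) q)"
    and mor_F: "\<And>s t p. 0 \<le> s \<Longrightarrow> s \<le> t \<Longrightarrow> mor F s t p \<in> hom (chains (obj F s) p) (chains (obj F t) p)"
    and mor_A: "\<And>s t q. 0 \<le> s \<Longrightarrow> s \<le> t \<Longrightarrow> mor A s t q \<in> hom (chains (obj A t) q) (chains (obj A s) q)"
begin

lemma coend_left_summand_hom:
  assumes "i \<in> coend_source_index"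
  shows "(case i of (s, t) \<Rightarrow> coend_inj F A t n \<circ> tensor_chain_map (obj F t) (obj A t) (mor F s t) (\<lambda>q. id) n)
    \<in> hom (coend_source_summand F A n i) (chains (coend_target F A) n)"
proof -
  obtain s t where i: "i = (s, t)" "0 \<le> s" "s \<le> t"
    using assms by auto
  have "tensor_chain_map (obj F t) (obj A t) (mor F s t) (\<lambda>q. id) n \<in>
      hom (coend_source_summand F A n i) (coend_target_summand F A n t)"
    using i by (simp, intro tensor_chain_map_hom F A mor_F iso_imp_homomorphism id_iso)
  then show ?thesis
    using hom_compose [OF _ coend_inj_hom [OF F A, of t n]] i by simp
qed

lemma coend_right_summand_hom:
  assumes "i \<in> coend_source_index"
  shows "(case i of (s, t) \<Rightarrow> coend_inj F A s n \<circ> tensor_chain_map (obj F s) (obj A s) (\<lambda>p. id) (mor A s t) n)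
    \<in> hom (coend_source_summand F A n i) (chains (coend_target F A) n)"
proof -
  obtain s t where i: "i = (s, t)" "0 \<le> s" "s \<le> t"
    using assms by auto
  have "tensor_chain_map (obj F s) (obj A s) (\<lambda>p. id) (mor A s t) n \<in>
      hom (coend_source_summand F A n i) (coend_target_summand F A n s)"
    using i by (simp, intro tensor_chain_map_hom F A mor_A iso_imp_homomorphism id_iso)
  then show ?thesis
    using hom_compose [OF _ coend_inj_hom [OF F A, of s n]] i by simp
qed

text \<open>
  The two coequalised maps in the shape of the universal property of the direct sum: a sum over the
  index of homomorphisms applied to the components.
\<close>
lemma coend_left_eq_gfinprod:
  "coend_left F A n = (\<lambda>x. gfinprod (chains (coend_target F A) n) (\<lambda>i. (case i of (s, t) \<Rightarrow>
     coend_inj F A t n \<circ> tensor_chain_map (obj F t) (obj A t) (mor F s t) (\<lambda>q. id) n) (x i)) coend_source_index)"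
  by (simp add: coend_left_def fun_eq_iff case_prod_unfold)

lemma coend_right_eq_gfinprod:
  "coend_right F A n = (\<lambda>x. gfinprod (chains (coend_target F A) n) (\<lambda>i. (case i of (s, t) \<Rightarrow>
     coend_inj F A s n \<circ> tensor_chain_map (obj F s) (obj A s) (\<lambda>p. id) (mor A s t) n) (x i)) coend_source_index)"
  by (simp add: coend_right_def fun_eq_iff case_prod_unfold)

lemma coend_left_hom: "coend_left F A n \<in> hom (chains (coend_source F A) n) (chains (coend_target F A) n)"
  unfolding coend_left_eq_gfinprod chains_coend_source
  by (intro comm_group.hom_group_sum coend_target_comm_group [OF F A] coend_left_summand_hom coend_source_summand_group [OF F A])

lemma coend_right_hom: "coend_right F A n \<in> hom (chains (coend_source F A) n) (chains (coend_target F A) n)"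
  unfolding coend_right_eq_gfinprod chains_coend_source
  by (intro comm_group.hom_group_sum coend_target_comm_group [OF F A] coend_right_summand_hom coend_source_summand_group [OF F A])

lemma coend_left_sum_inj:
  assumes st: "0 \<le> s" "s \<le> t" and w: "w \<in> carrier (chains (tensor_complex (obj F s) (obj A t)) n)"
  shows "coend_left F A n (sum_inj coend_source_index (coend_source_summand F A n) (s, t) w) =
    coend_inj F A t n (tensor_chain_map (obj F t) (obj A t) (mor F s t) (\<lambda>q. id) n w)"
  unfolding coend_left_eq_gfinprod
  by (subst gfinprod_sum_inj [OF coend_target_comm_group [OF F A] coend_source_summand_group [OF F A] coend_left_summand_hom])
     (use st w in auto)

lemma coend_right_sum_inj:
  assumes st: "0 \<le> s" "s \<le> t" and w: "w \<in> carrier (chains (tensor_complex (obj F s) (obj A t)) n)"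
  shows "coend_right F A n (sum_inj coend_source_index (coend_source_summand F A n) (s, t) w) =
    coend_inj F A s n (tensor_chain_map (obj F s) (obj A s) (\<lambda>p. id) (mor A s t) n w)"
  unfolding coend_right_eq_gfinprod
  by (subst gfinprod_sum_inj [OF coend_target_comm_group [OF F A] coend_source_summand_group [OF F A] coend_right_summand_hom])
     (use st w in auto)

lemma coeq_subgroup_coend_subgroup:
  "subgroup (coeq_subgroup (coend_source F A) (coend_target F A) (coend_left F A) (coend_right F A) n)
     (chains (coend_target F A) n)"
proof -
  interpret T: comm_group "chains (coend_target F A) n"
    by (rule coend_target_comm_group [OF F A])
  interpret l: group_hom "chains (coend_source F A) n" "chains (coend_target F A) n" "coend_left F A n"
    by (intro group_hom.intro group_hom_axioms.intro coend_source_group [OF F A] T.is_group coend_left_hom)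
  interpret r: group_hom "chains (coend_source F A) n" "chains (coend_target F A) n" "coend_right F A n"
    by (intro group_hom.intro group_hom_axioms.intro coend_source_group [OF F A] T.is_group coend_right_hom)
  have "(\<lambda>x. coend_left F A n x \<otimes>\<^bsub>chains (coend_target F A) n\<^esub>
      inv\<^bsub>chains (coend_target F A) n\<^esub> coend_right F A n x) \<in> hom (chains (coend_source F A) n) (chains (coend_target F A) n)"
    by (rule homI) (simp_all add: T.inv_mult T.m_ac)
  then show ?thesis
    unfolding coeq_subgroup_def
    by (intro group_hom.img_is_subgroup group_hom.intro group_hom_axioms.intro coend_source_group [OF F A] T.is_group)
qed

end

section \<open>Coefficients concentrated at one length\<close>

abbreviation coeff_cofunctor :: "real \<Rightarrow> int ch_diagram" where
  "coeff_cofunctor e \<equiv> concentrated_cofunctor (coeff e)"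

lemma obj_coeff_cofunctor:
  "obj (coeff_cofunctor e) l = (if l = e then integer_complex else concentrated (singleton_group 0))"
  by (simp add: concentrated_cofunctor_def coeff_def)

lemma obj_coeff_group: "group (obj (coeff e) l)"
  by (simp add: coeff_def)

lemma one_obj_coeff: "\<one>\<^bsub>obj (coeff e) l\<^esub> = 0"
  by (simp add: coeff_def singleton_group_def)

lemma chains_coeff_cofunctor_group: "group (chains (obj (coeff_cofunctor e) l) q)"
  by (simp add: concentrated_cofunctor_def concentrated_group obj_coeff_group)

lemma concentrated_map_hom:
  assumes "group B" "f \<in> hom A B"
  shows "concentrated_map B f q \<in> hom (chains (concentrated A) q) (chains (concentrated B) q)"
  using assms by (auto simp: concentrated_map_def chains_concentrated hom_def singleton_group_def)

lemma mor_coeff_cofunctor_hom: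
  assumes "0 \<le> s" "s \<le> t"
  shows "mor (coeff_cofunctor e) s t q \<in> hom (chains (obj (coeff_cofunctor e) t) q) (chains (obj (coeff_cofunctor e) s) q)"
proof -
  have "mor (coeff e) s t \<in> hom (obj (coeff e) t) (obj (coeff e) s)"
    by (auto simp: coeff_def hom_def singleton_group_def)
  then show ?thesis
    using concentrated_map_hom [OF obj_coeff_group] by (simp add: concentrated_cofunctor_def)
qed

lemma coeff_trans_hom:
  "concentrated_map (obj (coeff e') l) (coeff_trans e e' l) q \<in>
    hom (chains (obj (coeff_cofunctor e) l) q) (chains (obj (coeff_cofunctor e') l) q)"
proof -
  have "coeff_trans e e' l \<in> hom (obj (coeff e) l) (obj (coeff e') l)"
    by (auto simp: coeff_def hom_def singleton_group_def coeff_trans_def)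
  then show ?thesis
    using concentrated_map_hom [OF obj_coeff_group] by (simp add: concentrated_cofunctor_def)
qed

section \<open>The coend as the magnitude complex\<close>

context quasi_pseudometric_space
begin

abbreviation target :: "real \<Rightarrow> (real \<Rightarrow> nat \<times> nat \<Rightarrow> (('x list \<Rightarrow>\<^sub>0 int) \<times> int \<Rightarrow>\<^sub>0 int) set) complex_data" where
  "target e \<equiv> coend_target (CN X d) (coeff_cofunctor e)"

abbreviation relations :: "real \<Rightarrow> nat \<Rightarrow> (real \<Rightarrow> nat \<times> nat \<Rightarrow> (('x list \<Rightarrow>\<^sub>0 int) \<times> int \<Rightarrow>\<^sub>0 int) set) set" where
  "relations e n \<equiv> coeq_subgroup (coend_source (CN X d) (coeff_cofunctor e)) (target e)
     (coend_left (CN X d) (coeff_cofunctor e)) (coend_right (CN X d) (coeff_cofunctor e)) n"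

text \<open>
  The element \<open>x \<boxtimes> 1\<close> of the summand at \<open>e\<close>. All elements of the target are of this form, so the
  maps on the target below are understood through their effect on these elements.
\<close>
definition coend_unit :: "real \<Rightarrow> nat \<Rightarrow> ('x list \<Rightarrow>\<^sub>0 int) \<Rightarrow> real \<Rightarrow> nat \<times> nat \<Rightarrow> (('x list \<Rightarrow>\<^sub>0 int) \<times> int \<Rightarrow>\<^sub>0 int) set" where
  "coend_unit e n x = coend_inj (CN X d) (coeff_cofunctor e) e n (unit_tensor (obj (CN X d) e) n x)"

text \<open>
  Only the component at \<open>e\<close> in bidegree \<open>(n, 0)\<close> is read, since all others lie in trivial groups.
\<close>
definition coend_proj :: "real \<Rightarrow> nat \<Rightarrow> (real \<Rightarrow> nat \<times> nat \<Rightarrow> (('x list \<Rightarrow>\<^sub>0 int) \<times> int \<Rightarrow>\<^sub>0 int) set) \<Rightarrow> ('x list \<Rightarrow>\<^sub>0 int)" where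
  "coend_proj e n z = exact_length_part d e (integer_contraction (z e (n, 0)))"

lemma mor_CN_hom:
  assumes "0 \<le> s" "s \<le> t"
  shows "mor (CN X d) s t p \<in> hom (chains (obj (CN X d) s) p) (chains (obj (CN X d) t) p)"
  using assms by (force simp: mor_CN hom_def chains_CN)

lemmas coend_CN_assms = chains_CN_group chains_coeff_cofunctor_group mor_CN_hom mor_coeff_cofunctor_hom

lemma target_comm_group: "comm_group (chains (target e) n)"
  by (rule coend_target_comm_group [OF chains_CN_group chains_coeff_cofunctor_group])

lemma target_group: "group (chains (target e) n)"
  using target_comm_group [of e n] by (simp add: comm_group_def)

lemma coend_unit_hom:
  assumes "0 \<le> e"
  shows "coend_unit e n \<in> hom (chains (obj (CN X d) e) n) (chains (target e) n)"
proof -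
  have "coend_inj (CN X d) (coeff_cofunctor e) e n \<circ> unit_tensor (obj (CN X d) e) n
      \<in> hom (chains (obj (CN X d) e) n) (chains (target e) n)"
    by (rule hom_compose [OF unit_tensor_hom [OF chains_CN_group]])
       (use coend_inj_hom [OF chains_CN_group [of X d] chains_coeff_cofunctor_group [of e] assms, of n] in
         \<open>simp add: obj_coeff_cofunctor\<close>)
  then show ?thesis
    by (simp add: comp_def coend_unit_def [abs_def])
qed

lemma target_component_one:
  assumes e: "0 \<le> e" and z: "z \<in> carrier (chains (target e) n)" and s: "0 \<le> s" "s \<noteq> e"
  shows "z s = \<one>\<^bsub>chains (tensor_complex (obj (CN X d) s) (obj (coeff_cofunctor e) s)) n\<^esub>"
proof -
  have "z s \<in> carrier (coend_target_summand (CN X d) (coeff_cofunctor e) n s)"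
    by (rule coend_target_component [OF chains_CN_group chains_coeff_cofunctor_group z s(1)])
  then show ?thesis
    using s tensor_complex_trivial [OF chains_CN_group] by (simp add: obj_coeff_cofunctor)
qed

text \<open>
  All summands of the target other than the one at \<open>e\<close> vanish, because \<open>A\<^sub>e\<close> does, and the one at
  \<open>e\<close> is a tensor product with the integers.
\<close>
lemma target_cases:
  assumes e: "0 \<le> e" and z: "z \<in> carrier (chains (target e) n)"
  obtains x where "x \<in> carrier (chains (obj (CN X d) e) n)" "z = coend_unit e n x"
proof -
  note grp = coend_target_summand_group [OF chains_CN_group [of X d] chains_coeff_cofunctor_group [of e]]
  have "z e \<in> carrier (chains (tensor_complex (obj (CN X d) e) integer_complex) n)"
    using coend_target_component [OF chains_CN_group chains_coeff_cofunctor_group z e]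
    by (simp add: obj_coeff_cofunctor)
  then obtain x where x: "x \<in> carrier (chains (obj (CN X d) e) n)" and ze: "z e = unit_tensor (obj (CN X d) e) n x"
    using unit_tensor_cases [OF chains_CN_group] by metis
  have "z = coend_unit e n x"
    unfolding coend_unit_def coend_inj_def ze [symmetric]
    by (rule sum_inj_if_one_elsewhere [OF grp])
       (use e z target_component_one [OF e z] in \<open>auto simp: chains_coend_target\<close>)
  then show ?thesis
    using that x by blast
qed

lemma coend_unit_surj:
  assumes "0 \<le> e"
  shows "coend_unit e n ` carrier (chains (obj (CN X d) e) n) = carrier (chains (target e) n)"
  using target_cases [OF assms] hom_in_carrier [OF coend_unit_hom [OF assms]] by blast

lemma coend_proj_coend_unit:
  assumes e: "0 \<le> e" and x: "x \<in> carrier (chains (obj (CN X d) e) n)"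
  shows "coend_proj e n (coend_unit e n x) = exact_length_part d e x"
proof -
  have "(n, 0) \<in> bidegrees n"
    by (simp add: bidegrees_def)
  then have "coend_unit e n x e (n, 0) = pure_tensor (chains (obj (CN X d) e) n) integer_group x 1"
    using e by (simp add: coend_unit_def coend_inj_def sum_inj_def unit_tensor_apply [OF chains_CN_group])
  moreover have "integer_contraction (pure_tensor (chains (obj (CN X d) e) n) integer_group x 1) = x"
    unfolding chains_CN by (rule integer_contraction_pure_tensor) (use x in \<open>simp add: chains_CN\<close>)
  ultimately show ?thesis
    by (simp add: coend_proj_def)
qed

lemma coend_proj_hom:
  assumes "0 \<le> e"
  shows "coend_proj e n \<in> hom (chains (target e) n) (chains (obj (magnitude X d) e) n)"
  by (rule hom_if_hom_on_representatives [where f = "coend_proj e n",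
        OF chains_CN_group coend_unit_hom [OF assms] coend_unit_surj [OF assms] exact_length_part_hom])
     (rule coend_proj_coend_unit [OF assms])

lemma bdry_coend_unit:
  assumes e: "0 \<le> e" and x: "x \<in> carrier (chains (obj (CN X d) e) (Suc n))"
  shows "bdry (target e) n (coend_unit e (Suc n) x) = coend_unit e n (bdry (obj (CN X d) e) n x)"
proof
  fix s
  let ?T = "\<lambda>s. tensor_complex (obj (CN X d) s) (obj (coeff_cofunctor e) s)"
  have "bdry (?T s) n \<one>\<^bsub>chains (?T s) (Suc n)\<^esub> = \<one>\<^bsub>chains (?T s) n\<^esub>"
    by (intro bdry_tensor_complex_one chains_CN_group chains_coeff_cofunctor_group bdry_CN_hom)
       (simp add: concentrated_cofunctor_def bdry_concentrated_hom obj_coeff_group)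
  moreover have "bdry (?T e) n (unit_tensor (obj (CN X d) e) (Suc n) x) =
      unit_tensor (obj (CN X d) e) n (bdry (obj (CN X d) e) n x)"
    using bdry_unit_tensor [OF chains_CN_group bdry_CN_hom x] by (simp add: obj_coeff_cofunctor)
  ultimately show "bdry (target e) n (coend_unit e (Suc n) x) s = coend_unit e n (bdry (obj (CN X d) e) n x) s"
    using e by (simp add: coend_target_def sum_complex_def coend_unit_def coend_inj_def sum_inj_def)
qed

lemma bdry_target_hom:
  assumes e: "0 \<le> e"
  shows "bdry (target e) n \<in> hom (chains (target e) (Suc n)) (chains (target e) n)"
  by (rule hom_if_hom_on_representatives [where f = "bdry (target e) n",
        OF chains_CN_group coend_unit_hom [OF e] coend_unit_surj [OF e] hom_compose [OF bdry_CN_hom coend_unit_hom [OF e]]])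
     (simp add: bdry_coend_unit [OF e])

lemma coend_proj_chain_map:
  assumes e: "0 \<le> e"
  shows "chain_map (target e) (obj (magnitude X d) e) (coend_proj e)"
  unfolding chain_map_def
proof (intro conjI allI ballI coend_proj_hom [OF e])
  fix n z
  assume "z \<in> carrier (chains (target e) (Suc n))"
  then obtain x where x: "x \<in> carrier (chains (obj (CN X d) e) (Suc n))" and z: "z = coend_unit e (Suc n) x"
    using target_cases [OF e] by blast
  show "coend_proj e n (bdry (target e) n z) = bdry (obj (magnitude X d) e) n (coend_proj e (Suc n) z)"
    using hom_in_carrier [OF bdry_CN_hom x]
    by (simp add: z bdry_coend_unit [OF e x] coend_proj_coend_unit [OF e] x exact_length_part_bdry)
qed

lemma coend_proj_surj:
  assumes e: "0 \<le> e"
  shows "coend_proj e n ` carrier (chains (target e) n) = carrier (chains (obj (magnitude X d) e) n)"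
proof
  show "coend_proj e n ` carrier (chains (target e) n) \<subseteq> carrier (chains (obj (magnitude X d) e) n)"
    using hom_in_carrier [OF coend_proj_hom [OF e]] by blast
  show "carrier (chains (obj (magnitude X d) e) n) \<subseteq> coend_proj e n ` carrier (chains (target e) n)"
  proof
    fix x
    assume x: "x \<in> carrier (chains (obj (magnitude X d) e) n)"
    then have xC: "x \<in> carrier (chains (obj (CN X d) e) n)"
      by (rule magnitude_in_CN)
    have "x = coend_proj e n (coend_unit e n x)"
      by (simp add: coend_proj_coend_unit [OF e xC] exact_length_part_ident [OF x])
    then show "x \<in> coend_proj e n ` carrier (chains (target e) n)"
      using hom_in_carrier [OF coend_unit_hom [OF e] xC] by (rule image_eqI)
  qed
qed

text \<open>
  On the summand \<open>(s, e)\<close> of the source the left map includes \<open>CN(X)(s)\<close> into \<open>CN(X)(e)\<close>. The right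
  map applies \<open>A\<^sub>e(s \<le> e)\<close>, which is the identity for \<open>s = e\<close> and zero for \<open>s < e\<close>.
\<close>
lemma
  assumes st: "0 \<le> s" "s \<le> e" and x: "x \<in> carrier (chains (obj (CN X d) s) n)"
  defines "w \<equiv> sum_inj coend_source_index (coend_source_summand (CN X d) (coeff_cofunctor e) n) (s, e)
    (unit_tensor (obj (CN X d) s) n x)"
  shows coend_left_unit: "coend_left (CN X d) (coeff_cofunctor e) n w = coend_unit e n x"
    and coend_right_unit: "coend_right (CN X d) (coeff_cofunctor e) n w =
      (if s = e then coend_unit e n x else \<one>\<^bsub>chains (target e) n\<^esub>)"
proof -
  have u: "unit_tensor (obj (CN X d) s) n x \<in> carrier (chains (tensor_complex (obj (CN X d) s) (obj (coeff_cofunctor e) e)) n)"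
    using hom_in_carrier [OF unit_tensor_hom [OF chains_CN_group] x] by (simp add: obj_coeff_cofunctor)
  have "tensor_chain_map (obj (CN X d) e) integer_complex (mor (CN X d) s e) (\<lambda>q. id) n (unit_tensor (obj (CN X d) s) n x) =
      unit_tensor (obj (CN X d) e) n (mor (CN X d) s e n x)"
    by (rule tensor_chain_map_unit_tensor [OF chains_CN_group chains_CN_group mor_CN_hom [OF st] _ _ x])
       (simp_all add: iso_imp_homomorphism id_iso)
  then show "coend_left (CN X d) (coeff_cofunctor e) n w = coend_unit e n x"
    unfolding w_def coend_unit_def
    by (subst coend_left_sum_inj [OF coend_CN_assms st u]) (simp_all add: obj_coeff_cofunctor mor_CN)
  have right: "coend_right (CN X d) (coeff_cofunctor e) n w = coend_inj (CN X d) (coeff_cofunctor e) s n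
      (tensor_chain_map (obj (CN X d) s) (obj (coeff_cofunctor e) s) (\<lambda>p. id) (mor (coeff_cofunctor e) s e) n
        (unit_tensor (obj (CN X d) s) n x))"
    unfolding w_def by (rule coend_right_sum_inj [OF coend_CN_assms st u])
  show "coend_right (CN X d) (coeff_cofunctor e) n w =
      (if s = e then coend_unit e n x else \<one>\<^bsub>chains (target e) n\<^esub>)"
  proof (cases "s = e")
    case True
    have g: "mor (coeff_cofunctor e) e e q \<in> hom (chains integer_complex q) (chains integer_complex q)" for q
      using mor_coeff_cofunctor_hom [of e e e q] st by (simp add: obj_coeff_cofunctor)
    have g1: "mor (coeff_cofunctor e) e e 0 1 = 1"
      by (simp add: concentrated_cofunctor_def concentrated_map_def coeff_def)
    have "tensor_chain_map (obj (CN X d) s) integer_complex (\<lambda>p. id) (mor (coeff_cofunctor e) e e) n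
        (unit_tensor (obj (CN X d) s) n x) = unit_tensor (obj (CN X d) s) n (id x)"
      by (rule tensor_chain_map_unit_tensor [OF chains_CN_group chains_CN_group _ g g1 x])
         (simp add: iso_imp_homomorphism id_iso)
    then show ?thesis
      unfolding right using True by (simp add: obj_coeff_cofunctor coend_unit_def)
  next
    case False
    have g: "mor (coeff_cofunctor e) s e q \<in> hom (chains integer_complex q) (chains (obj (coeff_cofunctor e) s) q)" for q
      using mor_coeff_cofunctor_hom [of s e e q] st by (simp add: obj_coeff_cofunctor)
    have g1: "mor (coeff_cofunctor e) s e 0 1 = \<one>\<^bsub>chains (obj (coeff_cofunctor e) s) 0\<^esub>"
      using False by (simp add: concentrated_cofunctor_def concentrated_map_def coeff_def chains_concentrated singleton_group_def)
    have "tensor_chain_map (obj (CN X d) s) (obj (coeff_cofunctor e) s) (\<lambda>p. id) (mor (coeff_cofunctor e) s e) n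
        (unit_tensor (obj (CN X d) s) n x) = \<one>\<^bsub>coend_target_summand (CN X d) (coeff_cofunctor e) n s\<^esub>"
      by (rule tensor_chain_map_unit_tensor_zero [OF chains_CN_group chains_CN_group chains_coeff_cofunctor_group _ g g1 x])
         (simp add: iso_imp_homomorphism id_iso)
    moreover have "coend_inj (CN X d) (coeff_cofunctor e) s n
        \<one>\<^bsub>coend_target_summand (CN X d) (coeff_cofunctor e) n s\<^esub> = \<one>\<^bsub>chains (target e) n\<^esub>"
      by (rule hom_one [OF coend_inj_hom])
         (simp_all add: chains_CN_group chains_coeff_cofunctor_group st tensor_complex_group target_group)
    ultimately show ?thesis
      unfolding right using False by simp
  qed
qed

text \<open>
  It suffices to compare both sides on the summands \<open>(s, t)\<close> of the source. Those with \<open>t \<noteq> e\<close> are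
  trivial, and on those with \<open>t = e\<close> every element is of the form \<open>x \<boxtimes> 1\<close>. If \<open>s < e\<close>, then the
  left map gives a chain on tuples of length less than \<open>e\<close>, which has no part of length \<open>e\<close>.
\<close>
lemma coend_proj_left_eq_right:
  assumes e: "0 \<le> e" and w: "w \<in> carrier (chains (coend_source (CN X d) (coeff_cofunctor e)) n)"
  shows "coend_proj e n (coend_left (CN X d) (coeff_cofunctor e) n w) =
    coend_proj e n (coend_right (CN X d) (coeff_cofunctor e) n w)"
proof -
  let ?A = "coeff_cofunctor e"
  note source = coend_source_summand_group [OF chains_CN_group [of X d] chains_coeff_cofunctor_group [of e]]
  let ?l = "coend_proj e n \<circ> coend_left (CN X d) ?A n" and ?r = "coend_proj e n \<circ> coend_right (CN X d) ?A n"
  have M: "group (chains (obj (magnitude X d) e) n)"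
    by (simp add: chains_magnitude)
  have l: "?l \<in> hom (sum_group coend_source_index (coend_source_summand (CN X d) ?A n)) (chains (obj (magnitude X d) e) n)"
    using hom_compose [OF coend_left_hom [OF coend_CN_assms] coend_proj_hom [OF e]] by (simp add: chains_coend_source)
  have r: "?r \<in> hom (sum_group coend_source_index (coend_source_summand (CN X d) ?A n)) (chains (obj (magnitude X d) e) n)"
    using hom_compose [OF coend_right_hom [OF coend_CN_assms] coend_proj_hom [OF e]] by (simp add: chains_coend_source)
  have "?l w = ?r w"
  proof (rule sum_group_hom_eqI [OF source M l r])
    show "w \<in> carrier (sum_group coend_source_index (coend_source_summand (CN X d) ?A n))"
      using w by (simp add: chains_coend_source)
    fix i y
    assume i: "i \<in> coend_source_index" and y: "y \<in> carrier (coend_source_summand (CN X d) ?A n i)"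
    obtain s t where st: "i = (s, t)" "0 \<le> s" "s \<le> t"
      using i by auto
    show "?l (sum_inj coend_source_index (coend_source_summand (CN X d) ?A n) i y) =
        ?r (sum_inj coend_source_index (coend_source_summand (CN X d) ?A n) i y)"
    proof (cases "t = e")
      case True
      then have "y \<in> carrier (chains (tensor_complex (obj (CN X d) s) integer_complex) n)"
        using y st by (simp add: obj_coeff_cofunctor)
      then obtain x where x: "x \<in> carrier (chains (obj (CN X d) s) n)" and yx: "y = unit_tensor (obj (CN X d) s) n x"
        using unit_tensor_cases [OF chains_CN_group] by metis
      have se: "s \<le> e"
        using st True by simp
      have xe: "x \<in> carrier (chains (obj (CN X d) e) n)"
        using hom_in_carrier [OF mor_CN_hom [OF st(2) se] x] by (simp add: mor_CN)
      have "exact_length_part d e x = 0" if "s \<noteq> e"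
        unfolding exact_length_part_def using x se that by (intro frag_extend_eq_0) (auto simp: chains_CN)
      moreover have "coend_proj e n \<one>\<^bsub>chains (target e) n\<^esub> = 0"
        using hom_one [OF coend_proj_hom [OF e] target_group M] by (simp add: chains_magnitude)
      ultimately show ?thesis
        using coend_left_unit [OF st(2) se x] coend_right_unit [OF st(2) se x] True
        by (simp add: st(1) yx coend_proj_coend_unit [OF e xe])
    next
      case False
      then have "y = \<one>\<^bsub>coend_source_summand (CN X d) ?A n i\<^esub>"
        using y st tensor_complex_trivial [OF chains_CN_group] by (simp add: obj_coeff_cofunctor)
      then have "sum_inj coend_source_index (coend_source_summand (CN X d) ?A n) i y =
          \<one>\<^bsub>sum_group coend_source_index (coend_source_summand (CN X d) ?A n)\<^esub>"
        using hom_one [OF sum_inj_hom [OF source i] source sum_group [OF source]] by simp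
      then show ?thesis
        using hom_one [OF l sum_group [OF source] M] hom_one [OF r sum_group [OF source] M] by simp
    qed
  qed
  then show ?thesis
    by simp
qed

text \<open>
  A chain with no part of length \<open>e\<close> is a combination of tuples \<open>a\<close> of length \<open>l < e\<close>. Such a tuple is
  already a chain at \<open>l\<close>, so \<open>a \<boxtimes> 1\<close> at \<open>e\<close> is identified in the coend with a tensor at \<open>l\<close>, which is zero.
\<close>
lemma coend_unit_in_relations:
  assumes e: "0 \<le> e" and x: "x \<in> carrier (chains (obj (CN X d) e) n)" and zero: "exact_length_part d e x = 0"
  shows "coend_unit e n x \<in> relations e n"
proof -
  let ?A = "coeff_cofunctor e" and ?S = "{xs \<in> tuples X n. tuple_length d xs < e}"
  interpret K: subgroup "relations e n" "chains (target e) n"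
    by (rule coeq_subgroup_coend_subgroup [OF coend_CN_assms])
  interpret T: comm_group "chains (target e) n"
    by (rule target_comm_group)
  interpret u: group_hom "chains (obj (CN X d) e) n" "chains (target e) n" "coend_unit e n"
    by (intro group_hom.intro group_hom_axioms.intro chains_CN_group target_group coend_unit_hom e)
  have "Poly_Mapping.lookup x xs = 0" if "tuple_length d xs = e" for xs
    using lookup_exact_length_part [of d e x xs] that zero by simp
  then have "Poly_Mapping.keys x \<subseteq> ?S"
    using x by (fastforce simp: chains_CN in_keys_iff less_le)
  then show ?thesis
  proof (rule free_Abelian_group_induct)
    show "coend_unit e n 0 \<in> relations e n"
      using u.hom_one K.one_closed by (simp add: chains_CN)
    show "coend_unit e n (x - y) \<in> relations e n"
      if S: "Poly_Mapping.keys x \<subseteq> ?S" "Poly_Mapping.keys y \<subseteq> ?S"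
        and K: "coend_unit e n x \<in> relations e n" "coend_unit e n y \<in> relations e n" for x y
    proof -
      have xy: "x \<in> carrier (chains (obj (CN X d) e) n)" "y \<in> carrier (chains (obj (CN X d) e) n)"
        using S by (auto simp: chains_CN)
      have "x - y = x \<otimes>\<^bsub>chains (obj (CN X d) e) n\<^esub> inv\<^bsub>chains (obj (CN X d) e) n\<^esub> y"
        using xy by (simp add: chains_CN)
      then have "coend_unit e n (x - y) = coend_unit e n x \<otimes>\<^bsub>chains (target e) n\<^esub>
          inv\<^bsub>chains (target e) n\<^esub> coend_unit e n y"
        using xy by simp
      then show ?thesis
        using K by simp
    qed
    show "coend_unit e n (frag_of a) \<in> relations e n" if a: "a \<in> ?S" for a
    proof -
      define l where "l = tuple_length d a"
      have l: "0 \<le> l" "l \<le> e" "l \<noteq> e"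
        using a nonneg by (auto simp: l_def tuple_length_def tuples_def subset_iff intro!: sum_nonneg)
      have al: "frag_of a \<in> carrier (chains (obj (CN X d) l) n)"
        using a by (simp add: chains_CN l_def)
      \<comment> \<open>The left map sends \<open>w\<close> to \<open>a \<boxtimes> 1\<close> at \<open>e\<close>, and the right map sends it to zero.\<close>
      define w where "w = sum_inj coend_source_index (coend_source_summand (CN X d) ?A n) (l, e)
        (unit_tensor (obj (CN X d) l) n (frag_of a))"
      have "unit_tensor (obj (CN X d) l) n (frag_of a) \<in> carrier (coend_source_summand (CN X d) ?A n (l, e))"
        using hom_in_carrier [OF unit_tensor_hom [OF chains_CN_group] al] by (simp add: obj_coeff_cofunctor)
      then have "w \<in> carrier (chains (coend_source (CN X d) ?A) n)"
        unfolding w_def chains_coend_source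
        by (intro hom_in_carrier [OF sum_inj_hom] coend_source_summand_group chains_CN_group chains_coeff_cofunctor_group)
           (use l in auto)
      moreover have "coend_left (CN X d) ?A n w \<otimes>\<^bsub>chains (target e) n\<^esub>
          inv\<^bsub>chains (target e) n\<^esub> coend_right (CN X d) ?A n w = coend_unit e n (frag_of a)"
      proof -
        have "frag_of a \<in> carrier (chains (obj (CN X d) e) n)"
          using a by (simp add: chains_CN)
        then show ?thesis
          unfolding w_def coend_left_unit [OF l(1,2) al] coend_right_unit [OF l(1,2) al] using l(3) by simp
      qed
      ultimately show ?thesis
        unfolding coeq_subgroup_def by (metis (no_types, lifting) image_eqI)
    qed
  qed
qed

lemma kernel_coend_proj:
  assumes e: "0 \<le> e"
  shows "kernel (chains (target e) n) (chains (obj (magnitude X d) e) n) (coend_proj e n) = relations e n"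
proof
  show "kernel (chains (target e) n) (chains (obj (magnitude X d) e) n) (coend_proj e n) \<subseteq> relations e n"
  proof
    fix z
    assume "z \<in> kernel (chains (target e) n) (chains (obj (magnitude X d) e) n) (coend_proj e n)"
    then have z: "z \<in> carrier (chains (target e) n)" "coend_proj e n z = 0"
      by (simp_all add: kernel_def chains_magnitude)
    obtain x where x: "x \<in> carrier (chains (obj (CN X d) e) n)" and zx: "z = coend_unit e n x"
      using z(1) by (rule target_cases [OF e])
    show "z \<in> relations e n"
      unfolding zx using z(2) by (intro coend_unit_in_relations [OF e x]) (simp add: zx coend_proj_coend_unit [OF e x])
  qed
  interpret p: group_hom "chains (target e) n" "chains (obj (magnitude X d) e) n" "coend_proj e n"
    by (intro group_hom.intro group_hom_axioms.intro target_group coend_proj_hom e) (simp add: chains_magnitude)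
  show "relations e n \<subseteq> kernel (chains (target e) n) (chains (obj (magnitude X d) e) n) (coend_proj e n)"
    unfolding coeq_subgroup_def
  proof clarify
    fix w
    assume w: "w \<in> carrier (chains (coend_source (CN X d) (coeff_cofunctor e)) n)"
    note lr = hom_in_carrier [OF coend_left_hom [OF coend_CN_assms] w] hom_in_carrier [OF coend_right_hom [OF coend_CN_assms] w]
    show "coend_left (CN X d) (coeff_cofunctor e) n w \<otimes>\<^bsub>chains (target e) n\<^esub>
        inv\<^bsub>chains (target e) n\<^esub> coend_right (CN X d) (coeff_cofunctor e) n w
        \<in> kernel (chains (target e) n) (chains (obj (magnitude X d) e) n) (coend_proj e n)"
      using lr by (simp add: kernel_def coend_proj_left_eq_right [OF e w])
  qed
qed

lemmas coend_presentation = target_comm_group bdry_target_hom magnitude_chain_complex coend_proj_chain_map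
  coend_proj_surj kernel_coend_proj

text \<open>
  The chain-level map that induces \<open>CN(X) \<otimes> A\<^sub>e \<rightarrow> CN(X) \<otimes> A\<^sub>e\<^sub>'\<close> on the quotients.
\<close>
abbreviation coefficient_change :: "real \<Rightarrow> real \<Rightarrow> nat \<Rightarrow> (real \<Rightarrow> nat \<times> nat \<Rightarrow> (('x list \<Rightarrow>\<^sub>0 int) \<times> int \<Rightarrow>\<^sub>0 int) set) \<Rightarrow>
    real \<Rightarrow> nat \<times> nat \<Rightarrow> (('x list \<Rightarrow>\<^sub>0 int) \<times> int \<Rightarrow>\<^sub>0 int) set" where
  "coefficient_change e e' n \<equiv> \<lambda>z. \<lambda>s\<in>{0..}. tensor_chain_map (obj (CN X d) s) (obj (coeff_cofunctor e') s) (\<lambda>p. id)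
     (concentrated_map (obj (coeff e') s) (coeff_trans e e' s)) n (z s)"

lemma coefficient_change_coend_unit:
  assumes e: "0 \<le> e" and x: "x \<in> carrier (chains (obj (CN X d) e) n)"
  shows "coefficient_change e e' n (coend_unit e n x) =
    (if e = e' then coend_unit e' n x else \<one>\<^bsub>chains (target e') n\<^esub>)"
proof
  fix s
  let ?\<tau> = "\<lambda>s. concentrated_map (obj (coeff e') s) (coeff_trans e e' s)"
  have idh: "id \<in> hom G G" for G :: "('x list \<Rightarrow>\<^sub>0 int) monoid"
    by (simp add: iso_imp_homomorphism id_iso)
  have "tensor_chain_map (obj (CN X d) s) (obj (coeff_cofunctor e') s) (\<lambda>p. id) (?\<tau> s) n
      \<one>\<^bsub>chains (tensor_complex (obj (CN X d) s) (obj (coeff_cofunctor e) s)) n\<^esub> =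
      \<one>\<^bsub>chains (tensor_complex (obj (CN X d) s) (obj (coeff_cofunctor e') s)) n\<^esub>"
    by (intro hom_one [OF tensor_chain_map_hom] tensor_complex_group chains_CN_group chains_coeff_cofunctor_group
        coeff_trans_hom idh)
  moreover have "tensor_chain_map (obj (CN X d) e) (obj (coeff_cofunctor e') e) (\<lambda>p. id) (?\<tau> e) n
      (unit_tensor (obj (CN X d) e) n x) =
      (if e = e' then unit_tensor (obj (CN X d) e) n x
       else \<one>\<^bsub>chains (tensor_complex (obj (CN X d) e) (obj (coeff_cofunctor e') e)) n\<^esub>)"
  proof (cases "e = e'")
    case True
    have g: "?\<tau> e q \<in> hom (chains integer_complex q) (chains integer_complex q)" for q
      using coeff_trans_hom [of e' e e q] True by (simp add: obj_coeff_cofunctor)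
    have "tensor_chain_map (obj (CN X d) e) integer_complex (\<lambda>p. id) (?\<tau> e) n (unit_tensor (obj (CN X d) e) n x) =
        unit_tensor (obj (CN X d) e) n (id x)"
      by (rule tensor_chain_map_unit_tensor [OF chains_CN_group chains_CN_group idh g _ x])
         (use True in \<open>simp add: concentrated_map_def coeff_trans_def\<close>)
    then show ?thesis
      using True by (simp add: obj_coeff_cofunctor)
  next
    case False
    have g: "?\<tau> e q \<in> hom (chains integer_complex q) (chains (obj (coeff_cofunctor e') e) q)" for q
      using coeff_trans_hom [of e' e e q] by (simp add: obj_coeff_cofunctor)
    have "tensor_chain_map (obj (CN X d) e) (obj (coeff_cofunctor e') e) (\<lambda>p. id) (?\<tau> e) n
        (unit_tensor (obj (CN X d) e) n x) =
        \<one>\<^bsub>chains (tensor_complex (obj (CN X d) e) (obj (coeff_cofunctor e') e)) n\<^esub>"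
      by (rule tensor_chain_map_unit_tensor_zero
          [OF chains_CN_group chains_CN_group chains_coeff_cofunctor_group idh g _ x])
         (use False in \<open>simp add: concentrated_map_def coeff_trans_def concentrated_cofunctor_def
            chains_concentrated one_obj_coeff\<close>)
    then show ?thesis
      using False by simp
  qed
  ultimately show "coefficient_change e e' n (coend_unit e n x) s =
      (if e = e' then coend_unit e' n x else \<one>\<^bsub>chains (target e') n\<^esub>) s"
    using e by (auto simp: coend_unit_def coend_inj_def sum_inj_def chains_coend_target)
qed

lemma coefficient_change_hom:
  assumes e: "0 \<le> e" and e': "0 \<le> e'"
  shows "coefficient_change e e' n \<in> hom (chains (target e) n) (chains (target e') n)"
proof (rule hom_if_hom_on_representatives [where f = "coefficient_change e e' n",
      OF chains_CN_group coend_unit_hom [OF e] coend_unit_surj [OF e]])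
  show "(\<lambda>x. if e = e' then coend_unit e' n x else \<one>\<^bsub>chains (target e') n\<^esub>)
      \<in> hom (chains (obj (CN X d) e) n) (chains (target e') n)"
    using coend_unit_hom [OF e', of n] group.is_monoid [OF target_group [of e' n]]
    by (cases "e = e'") (simp_all add: hom_def)
qed (rule coefficient_change_coend_unit [OF e])

lemma coend_proj_coefficient_change:
  assumes e: "0 \<le> e" and e': "0 \<le> e'" and z: "z \<in> carrier (chains (target e) n)"
  shows "coend_proj e' n (coefficient_change e e' n z) = (if e = e' then coend_proj e n z else 0)"
proof -
  obtain x where x: "x \<in> carrier (chains (obj (CN X d) e) n)" and zx: "z = coend_unit e n x"
    using z by (rule target_cases [OF e])
  have "coend_proj e' n \<one>\<^bsub>chains (target e') n\<^esub> = 0"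
    using hom_one [OF coend_proj_hom [OF e'] target_group, of n] by (simp add: chains_magnitude)
  then show ?thesis
    unfolding zx coefficient_change_coend_unit [OF e x] by simp
qed

text \<open>
  The relations are the kernels of the projections, so the compatibility with the projections shows
  that relations are sent to relations.
\<close>
lemma mor_CN_coend_coeff_rcoset:
  assumes e: "0 \<le> e" and e': "0 \<le> e'" and z: "z \<in> carrier (chains (target e) n)"
  shows "mor (CN_coend_coeff X d) e e' n (relations e n #>\<^bsub>chains (target e) n\<^esub> z) =
    relations e' n #>\<^bsub>chains (target e') n\<^esub> coefficient_change e e' n z"
proof -
  have "coefficient_change e e' n ` relations e n \<subseteq> relations e' n"
    using hom_in_carrier [OF coefficient_change_hom [OF e e']] coend_proj_coefficient_change [OF e e']
    unfolding kernel_coend_proj [OF e, symmetric] kernel_coend_proj [OF e', symmetric]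
    by (auto simp: kernel_def chains_magnitude)
  then show ?thesis
    unfolding CN_coend_coeff_def diagram.simps coend_map_def
    by (intro quot_map_rcoset target_group coefficient_change_hom e e' z coeq_subgroup_coend_subgroup coend_CN_assms)
qed

lemma CN_coend_coeff_naturally_isomorphic_magnitude:
  "ch_naturally_isomorphic (CN_coend_coeff X d) (magnitude X d)"
proof (rule ch_naturally_isomorphic_transfer [OF magnitude_ch_functor])
  let ?\<eta> = "\<lambda>e n c. the_elem (coend_proj e n ` c)"
  have obj: "obj (CN_coend_coeff X d) e = coequaliser (coend_source (CN X d) (coeff_cofunctor e)) (target e)
      (coend_left (CN X d) (coeff_cofunctor e)) (coend_right (CN X d) (coeff_cofunctor e))" for e
    by (simp add: CN_coend_coeff_def coend_def)
  show "chain_complex (obj (CN_coend_coeff X d) e)" if "0 \<le> e" for e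
    unfolding obj
    by (rule coequaliser_chain_complex [where M = "obj (magnitude X d) e" and \<phi> = "coend_proj e"])
       (intro coend_presentation that)+
  show "chain_iso (obj (CN_coend_coeff X d) e) (obj (magnitude X d) e) (?\<eta> e)" if "0 \<le> e" for e
    unfolding obj
    by (rule coequaliser_iso) (intro coend_presentation that)+
  fix s t n c
  assume st: "0 \<le> s" "s \<le> t" and c: "c \<in> carrier (chains (obj (CN_coend_coeff X d) s) n)"
  then have t: "0 \<le> t"
    by simp
  obtain z where z: "z \<in> carrier (chains (target s) n)" and cz: "c = relations s n #>\<^bsub>chains (target s) n\<^esub> z"
    using c by (auto simp: obj coequaliser_def carrier_FactGroup)
  have mor: "mor (CN_coend_coeff X d) s t n c = relations t n #>\<^bsub>chains (target t) n\<^esub> coefficient_change s t n z"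
    unfolding cz by (rule mor_CN_coend_coeff_rcoset [OF st(1) t z])
  have closed: "coefficient_change s t n z \<in> carrier (chains (target t) n)"
    by (rule hom_in_carrier [OF coefficient_change_hom [OF st(1) t] z])
  then show "mor (CN_coend_coeff X d) s t n c \<in> carrier (chains (obj (CN_coend_coeff X d) t) n)"
    unfolding mor by (simp add: obj coequaliser_def carrier_FactGroup)
  have rep: "?\<eta> e n (relations e n #>\<^bsub>chains (target e) n\<^esub> z) = coend_proj e n z"
    if "0 \<le> e" "z \<in> carrier (chains (target e) n)" for e z
    by (rule coequaliser_iso_rcoset [where M = "obj (magnitude X d) e" and \<phi> = "coend_proj e"])
       (intro coend_presentation that)+
  show "?\<eta> t n (mor (CN_coend_coeff X d) s t n c) = mor (magnitude X d) s t n (?\<eta> s n c)"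
    unfolding mor unfolding cz rep [OF t closed] rep [OF st(1) z] coend_proj_coefficient_change [OF st(1) t z]
    by (simp add: magnitude_def)
qed

end

theorem proposition24:
  fixes X :: "'x set" and d :: "'x \<Rightarrow> 'x \<Rightarrow> real"
  assumes "quasi_pseudometric_space X d"
  shows "ch_naturally_isomorphic (CN_coend_coeff X d) (magnitude X d) \<and>
    (\<forall>n. ab_naturally_isomorphic (homology_functor n (magnitude X d))
           (homology_functor n (CN_coend_coeff X d)))"
proof -
  have iso: "ch_naturally_isomorphic (CN_coend_coeff X d) (magnitude X d)"
    by (rule quasi_pseudometric_space.CN_coend_coeff_naturally_isomorphic_magnitude [OF assms])
  then show ?thesis
    using ab_naturally_isomorphic_homology [OF ch_naturally_isomorphic_sym [OF iso]] by blast
qed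

end
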